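(* Let $f:\mathbb{R}^{n_0}\to\mathbb{R}$ be a continuous finitely piecewise linear function. Suppose that extending the codimension-one pieces of the non-linear locus of $f$ to full hyperplanes yields a fan $\Sigma$ in $\mathbb{R}^{n_0}$, that $f$ is the support function of a $\mathbb{Q}$-Cartier divisor on $\Sigma$, and that the ReLU Cartier divisor $D_f$ supported on $\Sigma$ satisfies $$D_f\cdot V(\tau_1)=D_f\cdot V(\tau_2)$$ for any two walls $\tau_1,\tau_2$ of $\Sigma$ contained in the same full hyperplane. Then $f\in\operatorname{ReLU}^{\mathbb{Q}}_{\mathbf{0}}(n_0,1)$.
   Context: A function $\mathbb{R}^{n_0}\to\mathbb{R}$ is finitely piecewise linear if $\mathbb{R}^{n_0}$ is a finite union of polyhedral sets (finite intersections of closed half-spaces) on each of which the function is affine linear. The non-linear locus of $f$ is the set of points having no neighborhood on which $f$ is affine linear; each of its codimension-one pieces spans a hyperplane, and these are the "full hyperplanes". $\Sigma$ is the collection of all faces of the closed chambers of the arrangement of these (finitely many) hyperplanes. $\varsigma$ applies $x\mapsto\max\{0,x\}$ to each coordinate. $\operatorname{ReLU}^{\mathbb{Q}}_{\mathbf{0}}(n_0,1)$ is the set of functions $\mathbb{R}^{n_0}\to\mathbb{R}$ of the form $L_2\circ\varsigma\circ L_1$, where $L_1:\mathbb{R}^{n_0}\to\mathbb{R}^{n_1}$ and $L_2:\mathbb{R}^{n_1}\to\mathbb{R}$ are linear maps with rational matrix entries, for some $n_1$. "$\Sigma$ is a fan" means every member of $\Sigma$ is a strongly convex rational polyhedral cone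 (with respect to $N=\mathbb{Z}^{n_0}$, $N_{\mathbb{R}}=\mathbb{R}^{n_0}$), $\Sigma$ is closed under taking faces, and intersections of members are faces of each. $M=\mathbb{Z}^{n_0}$ is the dual lattice and $\langle\cdot,\cdot\rangle$ is the dot product. That $f$ is the support function of a $\mathbb{Q}$-Cartier divisor on $\Sigma$ means that on each maximal cone $\sigma$ one has $f(u)=\langle m_\sigma,u\rangle$ for some $m_\sigma\in M\otimes\mathbb{Q}$. The ReLU Cartier divisor $D_f$ is the torus-invariant $\mathbb{Q}$-Cartier divisor on the toric variety $X_\Sigma$ with Cartier data $\{m_\sigma\}$ ($D_f=-\sum_\rho f(u_\rho)D_\rho$, where $u_\rho$ is the minimal generator of the ray $\rho$ and $D_\rho$ the corresponding torus-invariant prime divisor). A wall is a cone $\tau\in\Sigma$ of dimension $n_0-1$; it equals $\sigma\cap\sigma'$ for exactly two maximal cones $\sigma,\sigma'$, and $V(\tau)\cong\mathbb{P}^1$ is the corresponding complete torus-invariant curve in $X_\Sigma$. With $N_\tau=\operatorname{Span}(\tau)\cap N$, choose $u\in\sigma'\cap N$ whose image in $N/N_\tau\cong\mathbb{Z}$ is the minimal generator of the ray that is the image of $\sigma'$. Then $D_f\cdot V(\tau)=\langle m_\sigma-m_{\sigma'},u\rangle\in\mathbb{Q}$ (independent of the choices). *)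

theory Defs
  imports "HOL-Analysis.Analysis"
begin

section \<open>Piecewise linear functions\<close>

definition affine_linear_on :: "(real^'n) set \<Rightarrow> (real^'n \<Rightarrow> real) \<Rightarrow> bool" where
  "affine_linear_on S f \<longleftrightarrow> (\<exists>a b. \<forall>x\<in>S. f x = a \<bullet> x + b)"

definition finitely_piecewise_linear :: "(real^'n \<Rightarrow> real) \<Rightarrow> bool" where
  "finitely_piecewise_linear f \<longleftrightarrow>
     (\<exists>\<P>. finite \<P> \<and> \<Union>\<P> = UNIV \<and> (\<forall>P\<in>\<P>. polyhedron P \<and> affine_linear_on P f))"

definition nonlinear_locus :: "(real^'n \<Rightarrow> real) \<Rightarrow> (real^'n) set" where
  "nonlinear_locus f = {x. \<not> (\<exists>U. open U \<and> x \<in> U \<and> affine_linear_on U f)}"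

text \<open>
  The non-linear locus of a continuous finitely piecewise linear function is a finite union of
  polyhedra of codimension one.  Its codimension-one pieces depend on a choice of subdivision,
  but the hyperplanes they span do not, so we let every polyhedron of codimension one
  contained in the locus count as a piece.
\<close>

definition full_hyperplanes :: "(real^'n \<Rightarrow> real) \<Rightarrow> (real^'n) set set" where
  "full_hyperplanes f =
     {affine hull P | P. polyhedron P \<and> P \<subseteq> nonlinear_locus f \<and> aff_dim P = int CARD('n) - 1}"

definition closed_chambers :: "(real^'n) set set \<Rightarrow> (real^'n) set set" where
  "closed_chambers \<H> = closure ` components (- \<Union>\<H>)"

text \<open>The relation \<open>face_of\<close> also admits the empty set as a face, which is never a cone;
  it is excluded here and in \<open>is_fan\<close> below.\<close>

definition arrangement_faces :: "(real^'n) set set \<Rightarrow> (real^'n) set set" where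
  "arrangement_faces \<H> = {\<tau>. \<exists>\<sigma>\<in>closed_chambers \<H>. \<tau> face_of \<sigma> \<and> \<tau> \<noteq> {}}"

definition relu_fan :: "(real^'n \<Rightarrow> real) \<Rightarrow> (real^'n) set set" where
  "relu_fan f = arrangement_faces (full_hyperplanes f)"

section \<open>Fans\<close>

definition lattice_N :: "(real^'n) set" where
  "lattice_N = {x. \<forall>i. x $ i \<in> \<int>}"

definition rational_vectors :: "(real^'n) set" where
  "rational_vectors = {x. \<forall>i. x $ i \<in> \<rat>}"

definition rational_polyhedral_cone :: "(real^'n) set \<Rightarrow> bool" where
  "rational_polyhedral_cone \<sigma> \<longleftrightarrow>
     (\<exists>S. finite S \<and> S \<subseteq> lattice_N \<and> \<sigma> = convex_cone hull S)"

definition strongly_convex :: "(real^'n) set \<Rightarrow> bool" where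
  "strongly_convex \<sigma> \<longleftrightarrow> \<sigma> \<inter> uminus ` \<sigma> = {0}"

definition is_fan :: "(real^'n) set set \<Rightarrow> bool" where
  "is_fan \<F> \<longleftrightarrow>
     (\<forall>\<sigma>\<in>\<F>. rational_polyhedral_cone \<sigma> \<and> strongly_convex \<sigma>) \<and>
     (\<forall>\<sigma>\<in>\<F>. \<forall>\<tau>. \<tau> face_of \<sigma> \<and> \<tau> \<noteq> {} \<longrightarrow> \<tau> \<in> \<F>) \<and>
     (\<forall>\<sigma>\<in>\<F>. \<forall>\<sigma>'\<in>\<F>. (\<sigma> \<inter> \<sigma>') face_of \<sigma> \<and> (\<sigma> \<inter> \<sigma>') face_of \<sigma>')"

definition maximal_cones :: "(real^'n) set set \<Rightarrow> (real^'n) set set" where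
  "maximal_cones \<F> = {\<sigma>\<in>\<F>. \<forall>\<sigma>'\<in>\<F>. \<sigma> \<subseteq> \<sigma>' \<longrightarrow> \<sigma>' = \<sigma>}"

definition rays :: "(real^'n) set set \<Rightarrow> (real^'n) set set" where
  "rays \<F> = {\<rho>\<in>\<F>. dim \<rho> = 1}"

definition walls :: "(real^'n) set set \<Rightarrow> (real^'n) set set" where
  "walls \<F> = {\<tau>\<in>\<F>. dim \<tau> + 1 = CARD('n)}"

text \<open>The minimal generator of a ray is the generator of the semigroup of its lattice points.\<close>

definition ray_generator :: "(real^'n) set \<Rightarrow> real^'n" where
  "ray_generator \<rho> = (THE u. \<rho> \<inter> lattice_N = range (\<lambda>k::nat. real k *\<^sub>R u))"

section \<open>Torus-invariant divisors and their intersection with wall curves\<close>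

text \<open>
  A torus-invariant divisor \<open>\<Sum>\<rho>. D \<rho> D\<^sub>\<rho>\<close> on the toric variety of a fan is
  represented by its coefficients, as a function on the rays of the fan.
  The vectors \<open>m \<sigma>\<close> form Cartier data of it if it is the divisor of the character
  \<open>- m \<sigma>\<close> on the affine chart of each maximal cone \<open>\<sigma>\<close>.
\<close>

definition cartier_data ::
  "(real^'n) set set \<Rightarrow> ((real^'n) set \<Rightarrow> real) \<Rightarrow> ((real^'n) set \<Rightarrow> real^'n) \<Rightarrow> bool" where
  "cartier_data \<F> D m \<longleftrightarrow>
     (\<forall>\<sigma>\<in>maximal_cones \<F>. m \<sigma> \<in> rational_vectors \<and>
        (\<forall>\<rho>\<in>rays \<F>. \<rho> \<subseteq> \<sigma> \<longrightarrow> m \<sigma> \<bullet> ray_generator \<rho> = - D \<rho>))"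

definition qcartier_support_function :: "(real^'n) set set \<Rightarrow> (real^'n \<Rightarrow> real) \<Rightarrow> bool" where
  "qcartier_support_function \<F> f \<longleftrightarrow>
     (\<forall>\<sigma>\<in>maximal_cones \<F>. \<exists>m\<in>rational_vectors. \<forall>u\<in>\<sigma>. f u = m \<bullet> u)"

definition relu_divisor :: "(real^'n \<Rightarrow> real) \<Rightarrow> (real^'n) set \<Rightarrow> real" where
  "relu_divisor f = (\<lambda>\<rho>. - f (ray_generator \<rho>))"

text \<open>
  For a wall \<open>\<tau>\<close> of \<open>\<sigma>'\<close>, with \<open>N\<^sub>\<tau> = span \<tau> \<inter> N\<close>: the lattice vector \<open>u \<in> \<sigma>'\<close> maps to the
  minimal generator of the ray in \<open>N / N\<^sub>\<tau>\<close> that is the image of \<open>\<sigma>'\<close>.  The equation compares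
  preimages in \<open>N\<close>: on the left the lattice points whose image lies on that ray, on the right
  those whose image is a natural multiple of the image of \<open>u\<close>.
\<close>

definition quotient_ray_generator :: "(real^'n) set \<Rightarrow> (real^'n) set \<Rightarrow> real^'n \<Rightarrow> bool" where
  "quotient_ray_generator \<tau> \<sigma>' u \<longleftrightarrow>
     u \<in> \<sigma>' \<inter> lattice_N \<and>
     {v \<in> lattice_N. \<exists>t\<in>span \<tau>. v + t \<in> \<sigma>'} =
     {v \<in> lattice_N. \<exists>k::nat. v - real k *\<^sub>R u \<in> span \<tau> \<inter> lattice_N}"

text \<open>
  The intersection number \<open>D \<cdot> V(\<tau>)\<close> is \<open>\<langle>m\<^sub>\<sigma> - m\<^sub>\<sigma>\<^sub>', u\<rangle>\<close>, where \<open>\<tau> = \<sigma> \<inter> \<sigma>'\<close> separates the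
  maximal cones \<open>\<sigma>\<close> and \<open>\<sigma>'\<close>; the description operator selects the common value for all choices.
\<close>

definition intersection_number ::
  "(real^'n) set set \<Rightarrow> ((real^'n) set \<Rightarrow> real) \<Rightarrow> (real^'n) set \<Rightarrow> real" where
  "intersection_number \<F> D \<tau> =
     (THE q. \<exists>m \<sigma> \<sigma>' u. cartier_data \<F> D m \<and>
        \<sigma> \<in> maximal_cones \<F> \<and> \<sigma>' \<in> maximal_cones \<F> \<and> \<sigma> \<noteq> \<sigma>' \<and> \<tau> = \<sigma> \<inter> \<sigma>' \<and>
        quotient_ray_generator \<tau> \<sigma>' u \<and> q = (m \<sigma> - m \<sigma>') \<bullet> u)"

section \<open>Rational unbiased ReLU networks with one hidden layer\<close>

text \<open>
  The width of the hidden layer is a natural number that is quantified existentially, so vectors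
  of the hidden layer \<open>\<real>\<^sup>k\<close> are functions on \<open>nat\<close> that vanish from \<open>k\<close> on.
\<close>

definition hidden_map :: "nat \<Rightarrow> (nat \<Rightarrow> 'n \<Rightarrow> rat) \<Rightarrow> real^'n \<Rightarrow> (nat \<Rightarrow> real)" where
  "hidden_map k A x = (\<lambda>i. if i < k then \<Sum>j\<in>UNIV. of_rat (A i j) * x $ j else 0)"

definition relu_layer :: "(nat \<Rightarrow> real) \<Rightarrow> (nat \<Rightarrow> real)" where
  "relu_layer y = (\<lambda>i. max 0 (y i))"

definition output_map :: "nat \<Rightarrow> (nat \<Rightarrow> rat) \<Rightarrow> (nat \<Rightarrow> real) \<Rightarrow> real" where
  "output_map k c y = (\<Sum>i<k. of_rat (c i) * y i)"

definition ReLU_Q_0 :: "(real^'n \<Rightarrow> real) set" where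
  "ReLU_Q_0 = {output_map k c \<circ> relu_layer \<circ> hidden_map k A | k A c. True}"

end

theory Submission
  imports Defs
begin

text \<open>
  On each chamber \<open>f\<close> is a rational linear form, and across a wall in the hyperplane orthogonal to \<open>a\<close> this form
  changes by a multiple \<open>c a\<close> of the normal.  The intersection number with the wall curve is \<open>- c g\<close>,
  where \<open>g\<close> generates the group of values of \<open>a\<close> on the lattice, so the hypothesis says that \<open>c\<close>
  depends only on the hyperplane.  Hence \<open>f - (\<Sum>a. c a * max 0 (a \<bullet> x))\<close> has the same gradient on
  all chambers and is linear.
\<close>

section \<open>Hyperplanes and the non-linear locus\<close>

text \<open>Nothing in the hypotheses says that the hyperplanes pass through the origin or have
  rational normals. The first is forced by the fan condition, since a cone contains the origin; the
  second comes from \<open>f\<close> itself, whose gradient jump is a nonzero rational normal vector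
  at some wall of each hyperplane. The arrangement is therefore interpreted twice, with arbitrary
  normals and then with rational multiples of them, for which the values on the lattice form a
  cyclic group and \<open>g\<close> exists.

  Walls are handled through points lying on exactly one hyperplane, so that a wall, its two chambers
  and its span are read off from signs of linear forms. The jump a priori depends on such a point;
  as \<open>g\<close> is the same for all walls of one hyperplane, equal intersection numbers give
  equal jumps. Since \<open>intersection_number\<close> is a definite description, its evaluation
  requires uniqueness of Cartier data: they are prescribed on rays only, and the rays of a chamber
  span the whole space.\<close>

lemma convex_subset_Union_affine:
  fixes C :: "'a::real_vector set"
  assumes "finite \<A>" "convex C" "C \<noteq> {}" and aff: "\<And>A. A \<in> \<A> \<Longrightarrow> affine A"
    and "C \<subseteq> \<Union>\<A>"
  shows "\<exists>A\<in>\<A>. C \<subseteq> A"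
proof -
  have "\<exists>x\<in>C. x \<notin> \<Union>\<A>" if "\<And>A. A \<in> \<A> \<Longrightarrow> \<not> C \<subseteq> A"
    using \<open>finite \<A>\<close> that aff
  proof (induction \<A> rule: finite_induct)
    case empty
    then show ?case using \<open>C \<noteq> {}\<close> by auto
  next
    case (insert B \<B>)
    obtain x where x: "x \<in> C" "x \<notin> \<Union>\<B>" using insert by auto
    obtain y where y: "y \<in> C" "y \<notin> B" using insert.prems(1)[of B] by auto
    let ?p = "\<lambda>t. (1 - t) *\<^sub>R x + t *\<^sub>R y"
    \<comment> \<open>An affine set with two points on the line through \<open>x\<close> and
      \<open>y\<close> contains both \<open>x\<close> and \<open>y\<close>. But \<open>x\<close>
      avoids the members of \<open>\<B>\<close> and \<open>y\<close> avoids \<open>B\<close>, so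
      each set meets the line at most once and most of the segment avoids them all.\<close>
    have single: "\<exists>t0. {t. ?p t \<in> A} \<subseteq> {t0}" if "A \<in> insert B \<B>" for A
    proof (rule ccontr)
      assume "\<not> ?thesis"
      then obtain s t where st: "?p s \<in> A" "?p t \<in> A" "s \<noteq> t" by blast
      have "affine A" using insert.prems(2) that by auto
      then have *: "?p (s + r * (t - s)) \<in> A" for r
      proof -
        have "(1 - r) *\<^sub>R ?p s + r *\<^sub>R ?p t \<in> A"
          using mem_affine[OF \<open>affine A\<close> st(1,2), of "1 - r" r] by simp
        moreover have "(1 - r) *\<^sub>R ?p s + r *\<^sub>R ?p t = ?p (s + r * (t - s))"
          by (simp add: algebra_simps)
        ultimately show ?thesis by metis
      qed
      have "x \<in> A" using *[of "- s / (t - s)"] st(3) by simp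
      moreover have "y \<in> A" using *[of "(1 - s) / (t - s)"] st(3) by simp
      ultimately show False using x y that by auto
    qed
    have "finite {t. ?p t \<in> A}" if "A \<in> insert B \<B>" for A
      using single[OF that] finite_subset by blast
    then have "finite (\<Union>A\<in>insert B \<B>. {t. ?p t \<in> A})" using insert.hyps by blast
    moreover have "infinite {0..1::real}" by (simp add: infinite_Icc)
    ultimately obtain t where t: "t \<in> {0..1}" "t \<notin> (\<Union>A\<in>insert B \<B>. {t. ?p t \<in> A})"
      by (meson finite_subset subsetI)
    have "?p t \<in> C" using convexD[OF \<open>convex C\<close> x(1) y(1), of "1 - t" t] t by simp
    then show ?case using t by (intro bexI[of _ "?p t"]) auto
  qed
  then show ?thesis using assms(5) by blast
qed

text \<open>A ball has nonempty interior and so fits into no hyperplane; being convex, it then fits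
  into no finite union of hyperplanes.\<close>

lemma open_avoids_hyperplanes:
  fixes U :: "'a::euclidean_space set"
  assumes "open U" "U \<noteq> {}" "finite \<A>" and hyp: "\<And>A. A \<in> \<A> \<Longrightarrow> \<exists>a b. a \<noteq> 0 \<and> A = {x. a \<bullet> x = b}"
  obtains z where "z \<in> U" "z \<notin> \<Union>\<A>"
proof -
  obtain x e where e: "e > 0" "ball x e \<subseteq> U"
    using assms(1,2) openE by blast
  have "\<not> ball x e \<subseteq> A" if A: "A \<in> \<A>" for A
  proof -
    obtain a b where "a \<noteq> 0" "A = {x. a \<bullet> x = b}" using hyp[OF A] by auto
    then have "interior A = {}" by simp
    then show ?thesis using e(1) interior_maximal[OF _ open_ball] by (metis centre_in_ball empty_iff subsetD)
  qed
  moreover have "affine A" if A: "A \<in> \<A>" for A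
    using hyp[OF A] affine_hyperplane by auto
  ultimately have "\<not> ball x e \<subseteq> \<Union>\<A>"
    using convex_subset_Union_affine[OF \<open>finite \<A>\<close> convex_ball] e(1) by (metis centre_in_ball empty_iff)
  then show thesis using that e by blast
qed

text \<open>A point interior to each of the finitely many defining half-spaces is interior to
  \<open>P\<close>; any other point of \<open>P\<close> lies on a bounding hyperplane.\<close>

lemma polyhedron_diff_interior_subset_hyperplanes:
  fixes P :: "'a::euclidean_space set"
  assumes "polyhedron P"
  obtains \<K> where "finite \<K>" "\<And>K. K \<in> \<K> \<Longrightarrow> \<exists>a b. a \<noteq> 0 \<and> K = {x. a \<bullet> x = b}" "P - interior P \<subseteq> \<Union>\<K>"
proof -
  obtain F where F: "finite F" "P = \<Inter>F" "\<forall>h\<in>F. \<exists>a b. a \<noteq> 0 \<and> h = {x. a \<bullet> x \<le> b}"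
    using assms unfolding polyhedron_def by auto
  show thesis
  proof (rule that[of "frontier ` F"])
    show "finite (frontier ` F)" using F by simp
    show "\<exists>a b. a \<noteq> 0 \<and> K = {x. a \<bullet> x = b}" if K: "K \<in> frontier ` F" for K
    proof -
      obtain h where h: "h \<in> F" "K = frontier h" using K by auto
      obtain a b where ab: "a \<noteq> 0" "h = {x. a \<bullet> x \<le> b}" using F(3) h by auto
      show ?thesis using ab h frontier_halfspace_le[of a b] by auto
    qed
    show "P - interior P \<subseteq> \<Union> (frontier ` F)"
    proof
      fix x assume x: "x \<in> P - interior P"
      have "(\<Inter>h\<in>F. interior h) \<subseteq> interior P"
        using F(1,2) interior_subset by (intro interior_maximal open_INT) auto
      then obtain h where h: "h \<in> F" "x \<notin> interior h" using x by auto
      then show "x \<in> \<Union> (frontier ` F)"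
        using x F(2) closure_subset[of h] by (auto simp: frontier_def)
    qed
  qed
qed

text \<open>Interior points of a piece have a neighbourhood on which \<open>f\<close> is affine, so
  the locus lies in the sets \<open>P - interior P\<close>. Pieces of lower dimension need no
  separate treatment: their interior is empty, and their bounding hyperplanes cover them.\<close>

lemma nonlinear_locus_subset_hyperplanes:
  fixes f :: "real^'n \<Rightarrow> real"
  assumes "finitely_piecewise_linear f"
  obtains \<K> where "finite \<K>" "\<And>K. K \<in> \<K> \<Longrightarrow> \<exists>a b. a \<noteq> 0 \<and> K = {x. a \<bullet> x = b}" "nonlinear_locus f \<subseteq> \<Union>\<K>"
proof -
  obtain \<P> where P: "finite \<P>" "\<Union>\<P> = UNIV" "\<And>P. P \<in> \<P> \<Longrightarrow> polyhedron P \<and> affine_linear_on P f"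
    using assms unfolding finitely_piecewise_linear_def by auto
  have "\<forall>P\<in>\<P>. \<exists>\<K>. finite \<K> \<and> (\<forall>K\<in>\<K>. \<exists>a b. a \<noteq> 0 \<and> K = {x. a \<bullet> x = b}) \<and> P - interior P \<subseteq> \<Union>\<K>"
    using polyhedron_diff_interior_subset_hyperplanes P(3) by metis
  then obtain k where k: "\<And>P. P \<in> \<P> \<Longrightarrow> finite (k P)"
     "\<And>P K. P \<in> \<P> \<Longrightarrow> K \<in> k P \<Longrightarrow> \<exists>a b. a \<noteq> 0 \<and> K = {x. a \<bullet> x = b}"
     "\<And>P. P \<in> \<P> \<Longrightarrow> P - interior P \<subseteq> \<Union>(k P)"
    by metis
  show thesis
  proof (rule that[of "\<Union>(k ` \<P>)"])
    show "finite (\<Union>(k ` \<P>))" using k P by auto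
    show "\<exists>a b. a \<noteq> 0 \<and> K = {x. a \<bullet> x = b}" if "K \<in> \<Union>(k ` \<P>)" for K
      using that k(2) by auto
    show "nonlinear_locus f \<subseteq> \<Union>(\<Union>(k ` \<P>))"
    proof
      fix x assume x: "x \<in> nonlinear_locus f"
      obtain p where p: "p \<in> \<P>" "x \<in> p" using P(2) by auto
      have "affine_linear_on (interior p) f"
        using P(3)[OF p(1)] interior_subset unfolding affine_linear_on_def by blast
      then have "x \<notin> interior p" using x unfolding nonlinear_locus_def by auto
      then show "x \<in> \<Union>(\<Union>(k ` \<P>))" using p k(3)[OF p(1)] by blast
    qed
  qed
qed

text \<open>\<open>full_hyperplanes\<close> ranges over arbitrary polyhedra in the locus, not over
  the pieces of one subdivision, so finiteness needs an argument: each \<open>P\<close> is convex,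
  hence lies in a single member of the finite cover \<open>\<K>\<close>, and equal dimensions make
  its affine hull that member.\<close>

lemma finite_full_hyperplanes:
  fixes f :: "real^'n \<Rightarrow> real"
  assumes "finitely_piecewise_linear f"
  shows "finite (full_hyperplanes f)"
    and "H \<in> full_hyperplanes f \<Longrightarrow> \<exists>a b. a \<noteq> 0 \<and> H = {x. a \<bullet> x = b}"
proof -
  obtain \<K> where K: "finite \<K>" "\<And>K. K \<in> \<K> \<Longrightarrow> \<exists>a b. a \<noteq> 0 \<and> K = {x. a \<bullet> x = b}" "nonlinear_locus f \<subseteq> \<Union>\<K>"
    using nonlinear_locus_subset_hyperplanes[OF assms] by blast
  have sub: "full_hyperplanes f \<subseteq> \<K>"
  proof
    fix H assume "H \<in> full_hyperplanes f"
    then obtain P where P: "H = affine hull P" "polyhedron P" "P \<subseteq> nonlinear_locus f" "aff_dim P = int CARD('n) - 1"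
      unfolding full_hyperplanes_def by auto
    \<comment> \<open>The empty set has \<open>aff_dim\<close> -1; a positive number of coordinates
      therefore excludes it as a candidate for \<open>P\<close>.\<close>
    have "CARD('n) \<ge> 1" using zero_less_card_finite[where 'a='n] by linarith
    then have "P \<noteq> {}" using P(4) by auto
    moreover have "affine k" if "k \<in> \<K>" for k using K(2)[OF that] affine_hyperplane by auto
    moreover have "P \<subseteq> \<Union>\<K>" using P(3) K(3) by blast
    ultimately obtain k where k: "k \<in> \<K>" "P \<subseteq> k"
      using convex_subset_Union_affine[OF K(1) polyhedron_imp_convex[OF P(2)]] by blast
    obtain a b where ab: "a \<noteq> 0" "k = {x. a \<bullet> x = b}" using K(2)[OF k(1)] by blast
    have "H \<subseteq> k" using k P ab by (simp add: hull_minimal affine_hyperplane)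
    moreover have "aff_dim k = aff_dim H" using ab P by (simp add: aff_dim_hyperplane)
    ultimately have "H = k"
      using affine_dim_equal[of H k] ab P \<open>P \<noteq> {}\<close> by (simp add: affine_hyperplane)
    then show "H \<in> \<K>" using k by simp
  qed
  show "finite (full_hyperplanes f)" using sub K(1) finite_subset by blast
  show "H \<in> full_hyperplanes f \<Longrightarrow> \<exists>a b. a \<noteq> 0 \<and> H = {x. a \<bullet> x = b}" using sub K(2) by blast
qed

text \<open>Removing from \<open>d\<close> its projection to \<open>a\<close> leaves a vector
  orthogonal to \<open>a\<close>, hence by assumption to \<open>d\<close>, hence to itself.\<close>

lemma parallel_if_vanishes_on_hyperplane:
  fixes a d :: "'a::real_inner"
  assumes "a \<noteq> 0" and "\<And>y. a \<bullet> y = 0 \<Longrightarrow> d \<bullet> y = 0"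
  shows "d = ((d \<bullet> a) / (a \<bullet> a)) *\<^sub>R a"
proof -
  let ?w = "d - ((d \<bullet> a) / (a \<bullet> a)) *\<^sub>R a"
  have "a \<bullet> ?w = 0" using assms(1) by (simp add: inner_diff_right inner_commute)
  moreover from this have "d \<bullet> ?w = 0" by (rule assms(2))
  ultimately have "?w \<bullet> ?w = 0" by (simp add: inner_diff_left)
  then show ?thesis by simp
qed

section \<open>Sign vectors of finitely many linear forms\<close>

lemma sgn_mult_pos_iff: "0 < sgn u * v \<longleftrightarrow> u \<noteq> 0 \<and> sgn v = sgn u" for u v :: real
  by (auto simp: sgn_if split: if_splits)

text \<open>As no form vanishes at \<open>p\<close>, having the sign that it has at \<open>p\<close>
  is a strict linear inequality, so the cell is a finite intersection of open half-spaces.\<close>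

lemma sign_cell:
  fixes p :: "'a::real_inner"
  assumes "finite B" "\<And>b. b \<in> B \<Longrightarrow> b \<bullet> p \<noteq> 0"
  shows "open {y. \<forall>b\<in>B. sgn (b \<bullet> y) = sgn (b \<bullet> p)}"
    and "convex {y. \<forall>b\<in>B. sgn (b \<bullet> y) = sgn (b \<bullet> p)}"
proof -
  have "{y. \<forall>b\<in>B. sgn (b \<bullet> y) = sgn (b \<bullet> p)} = (\<Inter>b\<in>B. {y. (sgn (b \<bullet> p) *\<^sub>R b) \<bullet> y > 0})"
    using assms(2) by (auto simp: sgn_mult_pos_iff)
  moreover have "open (\<Inter>b\<in>B. {y. (sgn (b \<bullet> p) *\<^sub>R b) \<bullet> y > 0})"
    by (intro open_INT assms(1) ballI open_halfspace_gt)
  moreover have "convex (\<Inter>b\<in>B. {y. (sgn (b \<bullet> p) *\<^sub>R b) \<bullet> y > 0})"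
    by (intro convex_INT convex_halfspace_gt)
  ultimately show "open {y. \<forall>b\<in>B. sgn (b \<bullet> y) = sgn (b \<bullet> p)}"
    and "convex {y. \<forall>b\<in>B. sgn (b \<bullet> y) = sgn (b \<bullet> p)}"
    by simp_all
qed

lemma sgn_inner_stable:
  fixes p d :: "'a::real_inner"
  assumes "finite B" "\<And>b. b \<in> B \<Longrightarrow> b \<bullet> p \<noteq> 0"
  obtains e where "e > 0" "\<And>t b. \<bar>t\<bar> \<le> e \<Longrightarrow> b \<in> B \<Longrightarrow> sgn (b \<bullet> (p + t *\<^sub>R d)) = sgn (b \<bullet> p)"
proof -
  obtain r where r: "r > 0" "ball p r \<subseteq> {y. \<forall>b\<in>B. sgn (b \<bullet> y) = sgn (b \<bullet> p)}"
    using openE[OF sign_cell(1)[OF assms], of p] by blast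
  show thesis
  \<comment> \<open>The summand 1 keeps the denominator positive when \<open>d = 0\<close>.\<close>
  proof (rule that[of "r / (2 * (norm d + 1))"])
    have pos: "0 < 2 * (norm d + 1)" by (smt (verit) norm_ge_zero)
    show "0 < r / (2 * (norm d + 1))" using r(1) pos by simp
    fix t b assume t: "\<bar>t\<bar> \<le> r / (2 * (norm d + 1))" and b: "b \<in> B"
    have "\<bar>t\<bar> * norm d \<le> r / (2 * (norm d + 1)) * norm d"
      using t by (rule mult_right_mono) simp
    also have "\<dots> < r"
      using r(1) pos by (simp add: pos_divide_less_eq)
    finally have "p + t *\<^sub>R d \<in> ball p r" by (simp add: dist_norm)
    then show "sgn (b \<bullet> (p + t *\<^sub>R d)) = sgn (b \<bullet> p)" using r(2) b by blast
  qed
qed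

section \<open>Lattices and rational cones\<close>

lemma lattice_N_0: "0 \<in> lattice_N"
  by (simp add: lattice_N_def)

lemma lattice_N_add: "x \<in> lattice_N \<Longrightarrow> y \<in> lattice_N \<Longrightarrow> x + y \<in> lattice_N"
  by (simp add: lattice_N_def)

lemma lattice_N_scaleR: "c \<in> \<int> \<Longrightarrow> x \<in> lattice_N \<Longrightarrow> c *\<^sub>R x \<in> lattice_N"
  by (simp add: lattice_N_def)

lemma lattice_N_minus: "x \<in> lattice_N \<Longrightarrow> - x \<in> lattice_N"
  using lattice_N_scaleR[of "-1" x] by simp

lemma lattice_N_diff: "x \<in> lattice_N \<Longrightarrow> y \<in> lattice_N \<Longrightarrow> x - y \<in> lattice_N"
  using lattice_N_add[OF _ lattice_N_minus] by fastforce

lemma lattice_N_sum: "(\<And>s. s \<in> S \<Longrightarrow> g s \<in> lattice_N) \<Longrightarrow> sum g S \<in> lattice_N"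
  by (induction S rule: infinite_finite_induct) (auto simp: lattice_N_0 lattice_N_add)

lemma rational_vectors_diff:
  "x \<in> rational_vectors \<Longrightarrow> y \<in> rational_vectors \<Longrightarrow> x - y \<in> rational_vectors"
  by (simp add: rational_vectors_def)

lemma rational_vectors_add:
  "x \<in> rational_vectors \<Longrightarrow> y \<in> rational_vectors \<Longrightarrow> x + y \<in> rational_vectors"
  by (simp add: rational_vectors_def)

lemma rational_vectors_scaleR:
  "c \<in> \<rat> \<Longrightarrow> x \<in> rational_vectors \<Longrightarrow> c *\<^sub>R x \<in> rational_vectors"
  by (simp add: rational_vectors_def)

lemma rational_vectors_sum:
  "(\<And>s. s \<in> S \<Longrightarrow> g s \<in> rational_vectors) \<Longrightarrow> sum g S \<in> rational_vectors"
  by (induction S rule: infinite_finite_induct)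
     (auto simp: rational_vectors_add, auto simp: rational_vectors_def)

text \<open>The bounded denominator \<open>d\<close> makes \<open>G\<close> discrete. Its least
  positive element generates it, by division with remainder.\<close>

lemma additive_subgroup_generator:
  fixes G :: "real set"
  assumes diff: "\<And>x y. x \<in> G \<Longrightarrow> y \<in> G \<Longrightarrow> x - y \<in> G"
    and "d > 0" and discrete: "\<And>x. x \<in> G \<Longrightarrow> d * x \<in> \<int>" and "x0 \<in> G" "x0 \<noteq> 0"
  obtains g where "g \<in> G" "g > 0" "\<And>x. x \<in> G \<Longrightarrow> \<exists>k::int. x = of_int k * g"
proof -
  have zero: "0 \<in> G" using diff[OF \<open>x0 \<in> G\<close> \<open>x0 \<in> G\<close>] by simp
  have neg: "- x \<in> G" if "x \<in> G" for x using diff[OF zero that] by simp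
  have add: "x + y \<in> G" if "x \<in> G" "y \<in> G" for x y using diff[OF that(1) neg[OF that(2)]] by simp
  have natmul: "real n * x \<in> G" if "x \<in> G" for n x
    using that by (induction n) (auto simp: zero add algebra_simps)
  have mult: "of_int k * x \<in> G" if "x \<in> G" for k x
    using natmul[OF that] neg[OF natmul[OF that]] by (cases k) (simp_all del: of_nat_Suc)
  \<comment> \<open>Multiplication by \<open>d\<close> sends positive elements of \<open>G\<close>
    to positive natural numbers, among which a least one exists.\<close>
  define Q where "Q n \<longleftrightarrow> n > 0 \<and> (\<exists>x\<in>G. d * x = real n)" for n :: nat
  have natval: "\<exists>n. d * x = real n" if "x \<in> G" "x \<ge> 0" for x
    using discrete[OF that(1)] that(2) \<open>d > 0\<close>
    by (metis Ints_cases of_int_0_le_iff of_int_of_nat_eq mult_nonneg_nonneg less_imp_le zero_le_imp_eq_int)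
  have abs: "\<bar>x0\<bar> \<in> G" using \<open>x0 \<in> G\<close> neg by (simp add: abs_if)
  then obtain n where "d * \<bar>x0\<bar> = real n" using natval by force
  then have "Q n" using abs \<open>d > 0\<close> \<open>x0 \<noteq> 0\<close> unfolding Q_def
    by (metis mult_pos_pos of_nat_0_less_iff zero_less_abs_iff)
  define m where "m = (LEAST n. Q n)"
  have "Q m" unfolding m_def using \<open>Q n\<close> by (rule LeastI)
  then obtain g where g: "g \<in> G" "d * g = real m" "m > 0" unfolding Q_def by auto
  have "g > 0" using g \<open>d > 0\<close> by (metis of_nat_0_less_iff zero_less_mult_pos)
  have "\<exists>k::int. x = of_int k * g" if "x \<in> G" for x
  proof -
    \<comment> \<open>The remainder \<open>r\<close> lies in \<open>G\<close> and is smaller than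
      \<open>g\<close>, so minimality forces it to be 0.\<close>
    define k where "k = \<lfloor>x / g\<rfloor>"
    define r where "r = x - of_int k * g"
    have "r \<in> G" unfolding r_def using that mult[OF g(1)] diff by blast
    have r: "0 \<le> r" "r < g"
      using \<open>g > 0\<close> floor_divide_lower[of g x] floor_divide_upper[of g x]
      unfolding r_def k_def by (auto simp: algebra_simps)
    obtain n where n: "d * r = real n" using natval \<open>r \<in> G\<close> r by blast
    have "real n < real m" using n g(2) r \<open>d > 0\<close> by (metis mult_less_cancel_left_pos)
    then have "\<not> Q n" using not_less_Least unfolding m_def by (metis of_nat_less_iff)
    then have "n = 0" using n \<open>r \<in> G\<close> unfolding Q_def by (metis gr0I)
    then have "r = 0" using n \<open>d > 0\<close> by simp
    then show ?thesis unfolding r_def by (intro exI[of _ k]) simp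
  qed
  then show thesis using that g \<open>g > 0\<close> by blast
qed

lemma rational_vectors_common_denominator:
  fixes a :: "real^'n"
  assumes "a \<in> rational_vectors"
  obtains d :: real where "d > 0" "\<And>i. d * a $ i \<in> \<int>"
proof -
  have "\<exists>d::int. d > 0 \<and> of_int d * a $ i \<in> \<int>" for i
  proof -
    obtain p q :: int where "q > 0" "a $ i = of_int p / of_int q"
      using assms unfolding rational_vectors_def
      by (metis (mono_tags, lifting) Rats_cases' mem_Collect_eq)
    then show ?thesis by (intro exI[of _ q]) auto
  qed
  then obtain D :: "'n \<Rightarrow> int" where D: "\<And>i. D i > 0" "\<And>i. of_int (D i) * a $ i \<in> \<int>" by metis
  show thesis
  proof (rule that[of "of_int (\<Prod>i\<in>UNIV. D i)"])
    show "0 < real_of_int (prod D UNIV)" using D(1) by (simp add: prod_pos)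
    show "real_of_int (prod D UNIV) * a $ i \<in> \<int>" for i
    proof -
      have "real_of_int (prod D UNIV) * a $ i = of_int (prod D (UNIV - {i})) * (of_int (D i) * a $ i)"
        by (subst prod.remove[of UNIV i]) auto
      also have "\<dots> \<in> \<int>" using D(2)[of i] Ints_mult Ints_of_int by blast
      finally show ?thesis .
    qed
  qed
qed

text \<open>A common denominator of the coordinates of \<open>a\<close> makes its values on the
  lattice a discrete group. The generator \<open>a \<bullet> v0\<close> is the factor by which an
  intersection number differs from a gradient jump, up to sign.\<close>

lemma rational_functional_generator:
  fixes a :: "real^'n"
  assumes "a \<in> rational_vectors" "a \<noteq> 0"
  obtains v0 where "v0 \<in> lattice_N" "a \<bullet> v0 > 0" "\<And>v. v \<in> lattice_N \<Longrightarrow> \<exists>k::int. a \<bullet> v = of_int k * (a \<bullet> v0)"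
proof -
  obtain d :: real where d: "d > 0" "\<And>i. d * a $ i \<in> \<int>"
    using rational_vectors_common_denominator[OF assms(1)] by metis
  have int: "d * (a \<bullet> v) \<in> \<int>" if "v \<in> lattice_N" for v
  proof -
    have "d * (a \<bullet> v) = (\<Sum>i\<in>UNIV. (d * a $ i) * v $ i)"
      by (simp add: inner_vec_def sum_distrib_left mult.assoc)
    also have "\<dots> \<in> \<int>" using d(2) that unfolding lattice_N_def by (intro Ints_sum Ints_mult[OF d(2)]) blast
    finally show ?thesis .
  qed
  obtain i where i: "a $ i \<noteq> 0" using assms(2) by (metis vec_eq_iff zero_index)
  have ax: "axis i 1 \<in> lattice_N" by (simp add: lattice_N_def axis_def)
  show thesis
  proof (rule additive_subgroup_generator[of "(\<bullet>) a ` lattice_N" d "a $ i"])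
    show "x - y \<in> (\<bullet>) a ` lattice_N" if "x \<in> (\<bullet>) a ` lattice_N" "y \<in> (\<bullet>) a ` lattice_N" for x y
      using that by clarify (metis imageI inner_diff_right lattice_N_diff)
    show "a $ i \<in> (\<bullet>) a ` lattice_N"
      using ax by (metis cart_eq_inner_axis imageI)
    fix g assume "g \<in> (\<bullet>) a ` lattice_N" "g > 0"
      "\<And>x. x \<in> (\<bullet>) a ` lattice_N \<Longrightarrow> \<exists>k::int. x = of_int k * g"
    then show thesis using that by blast
  qed (use d int i in auto)
qed

text \<open>\<open>ray_generator\<close> is a definite description, so existence and uniqueness have
  to be shown before anything is known about it.\<close>

lemma lattice_points_of_ray:
  fixes v :: "real^'n"
  assumes "v \<in> lattice_N" "v \<noteq> 0" and \<rho>: "\<rho> = (\<lambda>t. t *\<^sub>R v) ` {0..}"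
  shows "ray_generator \<rho> \<in> \<rho>" "ray_generator \<rho> \<noteq> 0"
proof -
  obtain i where i: "v $ i \<noteq> 0" using assms(2) by (metis vec_eq_iff zero_index)
  have "\<exists>u. u \<in> \<rho> \<and> u \<noteq> 0 \<and> \<rho> \<inter> lattice_N = range (\<lambda>k::nat. real k *\<^sub>R u)"
  \<comment> \<open>The admissible multiples of \<open>v\<close> form a group, and a nonzero
    integral coordinate \<open>v $ i\<close> bounds their denominators.\<close>
  proof (rule additive_subgroup_generator[of "{t. t *\<^sub>R v \<in> lattice_N}" "\<bar>v $ i\<bar>" 1])
    show "x - y \<in> {t. t *\<^sub>R v \<in> lattice_N}" if "x \<in> {t. t *\<^sub>R v \<in> lattice_N}" "y \<in> {t. t *\<^sub>R v \<in> lattice_N}" for x y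
      using that lattice_N_diff by (auto simp: scaleR_diff_left)
    show "\<bar>v $ i\<bar> * x \<in> \<int>" if "x \<in> {t. t *\<^sub>R v \<in> lattice_N}" for x
    proof -
      have "x * v $ i \<in> \<int>" using that by (auto simp: lattice_N_def)
      then show ?thesis by (auto simp: abs_if mult.commute)
    qed
    fix g assume g: "g \<in> {t. t *\<^sub>R v \<in> lattice_N}" "g > 0"
      "\<And>x. x \<in> {t. t *\<^sub>R v \<in> lattice_N} \<Longrightarrow> \<exists>k::int. x = of_int k * g"
    have "\<rho> \<inter> lattice_N = range (\<lambda>k::nat. real k *\<^sub>R (g *\<^sub>R v))"
    proof (intro equalityI subsetI)
      fix x assume "x \<in> \<rho> \<inter> lattice_N"
      then obtain t where t: "t \<ge> 0" "x = t *\<^sub>R v" "t *\<^sub>R v \<in> lattice_N" using \<rho> by auto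
      then obtain k :: int where k: "t = of_int k * g" using g(3) by auto
      then have "k \<ge> 0" using t(1) g(2) by (simp add: zero_le_mult_iff)
      then have "x = real (nat k) *\<^sub>R (g *\<^sub>R v)" using k t by simp
      then show "x \<in> range (\<lambda>k::nat. real k *\<^sub>R (g *\<^sub>R v))" by blast
    next
      fix x assume "x \<in> range (\<lambda>k::nat. real k *\<^sub>R (g *\<^sub>R v))"
      then obtain k :: nat where k: "x = real k *\<^sub>R (g *\<^sub>R v)" by auto
      then have "x \<in> lattice_N" using g(1) lattice_N_scaleR[of "real k" "g *\<^sub>R v"] by auto
      moreover have "x \<in> \<rho>" unfolding \<rho> k using g(2) by (intro image_eqI[of _ _ "real k * g"]) auto
      ultimately show "x \<in> \<rho> \<inter> lattice_N" by blast
    qed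
    then show ?thesis
      using g(2) assms(2) \<rho> by (intro exI[of _ "g *\<^sub>R v"]) auto
  qed (use i assms in auto)
  then obtain u where u: "u \<in> \<rho>" "u \<noteq> 0" "\<rho> \<inter> lattice_N = range (\<lambda>k::nat. real k *\<^sub>R u)" by blast
  have "ray_generator \<rho> = u"
    unfolding ray_generator_def
  proof (rule the_equality)
    fix w assume w: "\<rho> \<inter> lattice_N = range (\<lambda>k::nat. real k *\<^sub>R w)"
    have self: "x \<in> range (\<lambda>k::nat. real k *\<^sub>R x)" for x :: "real^'n"
      by (rule image_eqI[of _ _ 1]) auto
    have "w \<in> range (\<lambda>k::nat. real k *\<^sub>R u)" "u \<in> range (\<lambda>k::nat. real k *\<^sub>R w)"
      using self[of u] self[of w] w u(3) by auto
    then obtain k l where k: "w = real k *\<^sub>R u" and l: "u = real l *\<^sub>R w" by blast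
    \<comment> \<open>Two generators are natural multiples of each other, with factors whose product
      is 1.\<close>
    have "u = (real l * real k) *\<^sub>R u" using l unfolding k scaleR_scaleR .
    then have "real (l * k) = 1" using u(2) by (metis of_nat_mult scaleR_cancel_right scaleR_one)
    then have "k = 1" by (metis nat_mult_eq_1_iff of_nat_eq_1_iff)
    then show "w = u" using k by simp
  qed (fact u(3))
  then show "ray_generator \<rho> \<in> \<rho>" "ray_generator \<rho> \<noteq> 0" using u by auto
qed

section \<open>Strongly convex rational cones and their extreme rays\<close>

lemma strongly_convex_uminus: "strongly_convex \<sigma> \<Longrightarrow> x \<in> \<sigma> \<Longrightarrow> - x \<in> \<sigma> \<Longrightarrow> x = 0"
  unfolding strongly_convex_def by (metis IntI add.inverse_inverse imageI singletonD)

text \<open>Dimension 1 confines the cone to the line of a nonzero generator \<open>v\<close>, and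
  strong convexity excludes the negative multiples.\<close>

lemma one_dimensional_cone:
  fixes \<rho> :: "(real^'n) set"
  assumes "rational_polyhedral_cone \<rho>" "strongly_convex \<rho>" "dim \<rho> = 1"
  obtains v where "v \<in> lattice_N" "v \<noteq> 0" "\<rho> = (\<lambda>t. t *\<^sub>R v) ` {0..}"
proof -
  obtain S where S: "finite S" "S \<subseteq> lattice_N" "\<rho> = convex_cone hull S"
    using assms unfolding rational_polyhedral_cone_def by auto
  have "\<not> S \<subseteq> {0}"
  proof
    assume "S \<subseteq> {0}"
    then have "convex_cone hull S \<subseteq> {0}" by (intro hull_minimal) auto
    then show False using S assms(3) dim_eq_0[of \<rho>] by simp
  qed
  then obtain v where v: "v \<in> S" "v \<noteq> 0" by auto
  have v\<rho>: "v \<in> \<rho>" using S v by (simp add: hull_inc)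
  have "span {v} = span \<rho>"
    using v\<rho> v assms(3) by (intro dim_eq_span) (auto simp: dim_singleton)
  then have sp: "\<rho> \<subseteq> span {v}" using span_superset by blast
  have cc: "t *\<^sub>R v \<in> \<rho>" if "t \<ge> 0" for t using v\<rho> S(3) convex_cone_hull_mul that by auto
  have "\<rho> = (\<lambda>t. t *\<^sub>R v) ` {0..}"
  proof (intro equalityI subsetI)
    fix x assume x: "x \<in> \<rho>"
    then obtain t where t: "x = t *\<^sub>R v" using sp by (auto simp: span_singleton)
    show "x \<in> (\<lambda>t. t *\<^sub>R v) ` {0..}"
    proof (cases "t \<ge> 0")
      case False
      then have "- x \<in> \<rho>" using cc[of "- t"] t by simp
      then have "x = 0" using strongly_convex_uminus assms(2) x by blast
      then show ?thesis by (intro image_eqI[of _ _ 0]) auto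
    qed (use t in auto)
  qed (use cc in auto)
  then show thesis using that v S by blast
qed

lemma convex_cone_hull_insert_elt:
  assumes "x \<in> convex_cone hull (insert s S)"
  obtains t w where "t \<ge> 0" "w \<in> convex_cone hull S" "x = t *\<^sub>R s + w"
proof -
  have *: "convex_cone hull {s} \<subseteq> (\<lambda>t. t *\<^sub>R s) ` {0..}"
  proof (rule hull_minimal)
    show "{s} \<subseteq> (\<lambda>t. t *\<^sub>R s) ` {0..}" by (auto intro: image_eqI[of _ _ 1])
    show "convex_cone ((\<lambda>t. t *\<^sub>R s) ` {0..})"
      unfolding convex_cone_iff by (force simp: image_iff simp flip: scaleR_add_left)
  qed
  have "x \<in> convex_cone hull ({s} \<union> S)" using assms by simp
  then show thesis using that * unfolding convex_cone_hull_Un by force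
qed

lemma cone_spanned_by_extreme_rays:
  fixes \<sigma> :: "(real^'n) set"
  assumes "rational_polyhedral_cone \<sigma>" "strongly_convex \<sigma>"
  shows "\<exists>S\<subseteq>lattice_N. \<sigma> \<subseteq> span S \<and> (\<forall>s\<in>S. s \<noteq> 0 \<and> (\<lambda>t. t *\<^sub>R s) ` {0..} face_of \<sigma>)"
proof -
  \<comment> \<open>In a generating set of least size every element spans an extreme ray.\<close>
  define Q where "Q n \<longleftrightarrow> (\<exists>S. finite S \<and> S \<subseteq> lattice_N \<and> \<sigma> = convex_cone hull S \<and> card S = n)" for n
  have "\<exists>n. Q n" using assms(1) unfolding rational_polyhedral_cone_def Q_def by auto
  then have "Q (LEAST n. Q n)" by (rule LeastI_ex)
  then obtain S where S: "finite S" "S \<subseteq> lattice_N" "\<sigma> = convex_cone hull S" "card S = (LEAST n. Q n)"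
    unfolding Q_def by auto
  have minimal: "s \<notin> convex_cone hull (S - {s})" if "s \<in> S" for s
  proof
    assume "s \<in> convex_cone hull (S - {s})"
    then have "convex_cone hull (S - {s}) = convex_cone hull S"
      using hull_redundant[of s convex_cone "S - {s}"] that by (simp add: insert_absorb)
    then have "Q (card (S - {s}))" unfolding Q_def using S by auto
    moreover have "card (S - {s}) < card S" using S(1) that by (rule card_Diff1_less)
    ultimately show False using S(4) not_less_Least by metis
  qed
  show ?thesis
  proof (intro exI[of _ S] conjI ballI)
    show "\<sigma> \<subseteq> span S" using S(3) by (simp add: hull_minimal convex_cone_span span_superset)
    fix s assume s: "s \<in> S"
    let ?W = "convex_cone hull (S - {s})"
    let ?R = "(\<lambda>t. t *\<^sub>R s) ` {0..}"
    have W\<sigma>: "?W \<subseteq> \<sigma>" unfolding S(3) by (rule hull_mono) auto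
    have "s \<noteq> 0" using minimal[OF s] convex_cone_hull_contains_0 by metis
    have scale: "t *\<^sub>R s \<in> \<sigma>" if "t \<ge> 0" for t
      using s S(3) convex_cone_hull_mul hull_inc that by metis
    have face: "x \<in> ?R \<and> y \<in> ?R" if xy: "x \<in> \<sigma>" "y \<in> \<sigma>" "t \<ge> 0" "t *\<^sub>R s \<in> open_segment x y" for x y t
    proof -
      obtain \<mu> where \<mu>: "0 < \<mu>" "\<mu> < 1" "t *\<^sub>R s = (1 - \<mu>) *\<^sub>R x + \<mu> *\<^sub>R y"
        using xy(4) by (auto simp: in_segment)
      have \<sigma>: "\<sigma> = convex_cone hull (insert s (S - {s}))" using S(3) s by (simp add: insert_absorb)
      obtain c w where c: "c \<ge> 0" "w \<in> ?W" "x = c *\<^sub>R s + w"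
        using convex_cone_hull_insert_elt xy(1) unfolding \<sigma> by metis
      obtain d z where d: "d \<ge> 0" "z \<in> ?W" "y = d *\<^sub>R s + z"
        using convex_cone_hull_insert_elt xy(2) unfolding \<sigma> by metis
      \<comment> \<open>Here \<open>e\<close> collects the multiples of \<open>s\<close> contributed
        by \<open>x\<close> and \<open>y\<close> to the point on the segment, and \<open>v\<close>
        the contributions of the other generators.\<close>
      define e where "e = (1 - \<mu>) * c + \<mu> * d"
      define v where "v = (1 - \<mu>) *\<^sub>R w + \<mu> *\<^sub>R z"
      have wz: "(1 - \<mu>) *\<^sub>R w \<in> ?W" "\<mu> *\<^sub>R z \<in> ?W"
        using convex_cone_hull_mul[OF c(2), of "1 - \<mu>"] convex_cone_hull_mul[OF d(2), of \<mu>] \<mu>(1,2) by auto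
      then have "v \<in> ?W" unfolding v_def by (rule convex_cone_hull_add)
      have eq: "(t - e) *\<^sub>R s = v"
        using \<mu>(3) unfolding c(3) d(3) e_def v_def by (simp add: algebra_simps)
      \<comment> \<open>If \<open>t > e\<close>, then \<open>s\<close> would be redundant as a
        generator. Otherwise \<open>- v\<close> lies in the cone along with \<open>v\<close>, so
        strong convexity gives \<open>v = 0\<close>; applied once more to the two summands of
        \<open>v\<close>, it leaves \<open>x\<close> and \<open>y\<close> on the ray.\<close>
      have "\<not> t > e"
      proof
        assume "t > e"
        then have "s = (1 / (t - e)) *\<^sub>R v" using eq by (metis diff_gt_0_iff_gt divide_self_if less_irrefl scaleR_one scaleR_scaleR times_divide_eq_left mult_1)
        then have "s \<in> ?W" using \<open>v \<in> ?W\<close> \<open>t > e\<close> convex_cone_hull_mul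
          by (metis diff_gt_0_iff_gt less_eq_real_def zero_less_divide_1_iff)
        then show False using minimal[OF s] by simp
      qed
      then have "- v \<in> \<sigma>" using scale[of "e - t"] eq by (metis diff_ge_0_iff_ge linorder_not_less minus_diff_eq scaleR_minus_left)
      then have "v = 0" using strongly_convex_uminus assms(2) \<open>v \<in> ?W\<close> W\<sigma> by blast
      then have "- ((1 - \<mu>) *\<^sub>R w) = \<mu> *\<^sub>R z" unfolding v_def by (simp add: minus_unique)
      then have "(1 - \<mu>) *\<^sub>R w = 0"
        using strongly_convex_uminus[OF assms(2)] wz W\<sigma> by (metis subsetD)
      then have "w = 0" "z = 0" using \<open>v = 0\<close> \<mu> unfolding v_def by auto
      then show ?thesis using c d by auto
    qed
    have "convex ?R"
      by (intro convex_linear_image) (auto simp: linear_iff scaleR_add_left)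
    then show "?R face_of \<sigma>"
      unfolding face_of_def using scale face by (auto simp: image_iff)
    show "s \<noteq> 0" by fact
  qed (use S in auto)
qed

section \<open>Central arrangements\<close>

text \<open>Hyperplanes are represented by chosen normals, because chambers are compared through the
  signs of linear forms. Injectivity gives one normal per hyperplane, so that no two normals are
  proportional.\<close>

locale linear_arrangement =
  fixes V :: "(real^'n) set"
  assumes finite_V: "finite V" and V_nonzero: "0 \<notin> V"
    and inj_V: "inj_on (\<lambda>a. {x. a \<bullet> x = 0}) V"
begin

definition hyps :: "(real^'n) set set" where
  "hyps = (\<lambda>a. {x. a \<bullet> x = 0}) ` V"

definition generic :: "real^'n \<Rightarrow> bool" where
  "generic x \<longleftrightarrow> (\<forall>a\<in>V. a \<bullet> x \<noteq> 0)"

text \<open>For generic \<open>x\<close> this is the closure of the component of \<open>x\<close>.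
  At other \<open>x\<close>, a form vanishing at \<open>x\<close> imposes no condition, as its sign
  is 0.\<close>

definition cchamber :: "real^'n \<Rightarrow> (real^'n) set" where
  "cchamber x = {y. \<forall>a\<in>V. 0 \<le> sgn (a \<bullet> x) * (a \<bullet> y)}"

text \<open>These points index the walls: such a \<open>p\<close> lies in the relative interior of
  exactly one of them, \<open>wall a p\<close>, and \<open>half a p 1\<close> and
  \<open>half a p (-1)\<close> are the two chambers beside it.\<close>

definition wall_point :: "real^'n \<Rightarrow> real^'n \<Rightarrow> bool" where
  "wall_point a p \<longleftrightarrow> a \<in> V \<and> a \<bullet> p = 0 \<and> (\<forall>b\<in>V - {a}. b \<bullet> p \<noteq> 0)"

definition half :: "real^'n \<Rightarrow> real^'n \<Rightarrow> real \<Rightarrow> (real^'n) set" where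
  "half a p s = {y. 0 \<le> s * (a \<bullet> y) \<and> (\<forall>b\<in>V - {a}. 0 \<le> sgn (b \<bullet> p) * (b \<bullet> y))}"

definition wall :: "real^'n \<Rightarrow> real^'n \<Rightarrow> (real^'n) set" where
  "wall a p = {y. a \<bullet> y = 0 \<and> (\<forall>b\<in>V - {a}. 0 \<le> sgn (b \<bullet> p) * (b \<bullet> y))}"

lemma not_parallel:
  assumes "a \<in> V" "b \<in> V" "a \<noteq> b" "r \<noteq> 0"
  shows "r *\<^sub>R a \<noteq> q *\<^sub>R b"
proof
  assume eq: "r *\<^sub>R a = q *\<^sub>R b"
  then have q: "q \<noteq> 0" using assms V_nonzero by auto
  have "r * (a \<bullet> x) = q * (b \<bullet> x)" for x using arg_cong[OF eq, of "\<lambda>w. w \<bullet> x"] by simp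
  then have "a \<bullet> x = 0 \<longleftrightarrow> b \<bullet> x = 0" for x using q assms(4) by (metis mult_eq_0_iff)
  then show False using inj_V assms(1-3) by (auto simp: inj_on_def)
qed

lemma Compl_Union_hyps: "- \<Union>hyps = Collect generic"
  by (auto simp: hyps_def generic_def)

lemma cchamber_self: "x \<in> cchamber x"
  by (simp add: cchamber_def sgn_if)

lemma cchamber_cong: "(\<And>a. a \<in> V \<Longrightarrow> sgn (a \<bullet> x) = sgn (a \<bullet> y)) \<Longrightarrow> cchamber x = cchamber y"
  by (auto simp: cchamber_def)

text \<open>The cell is convex and hence connected; conversely, by the intermediate value theorem, a
  form cannot change sign on a connected set that avoids its zeros.\<close>

lemma component_eq_sign_cell:
  assumes "generic x"
  shows "connected_component_set (- \<Union>hyps) x = {y. \<forall>a\<in>V. sgn (a \<bullet> y) = sgn (a \<bullet> x)}" (is "_ = ?C")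
proof (rule antisym)
  have "connected ?C"
    using sign_cell(2)[OF finite_V] assms unfolding generic_def by (intro convex_connected) auto
  moreover have "?C \<subseteq> Collect generic"
    using assms by (auto simp: generic_def) (metis sgn_0_0)
  ultimately show "?C \<subseteq> connected_component_set (- \<Union>hyps) x"
    unfolding Compl_Union_hyps by (intro connected_component_maximal) auto
  show "connected_component_set (- \<Union>hyps) x \<subseteq> ?C"
  proof (intro subsetI CollectI ballI)
    fix y a assume y: "y \<in> connected_component_set (- \<Union>hyps) x" and a: "a \<in> V"
    then obtain T where T: "connected T" "T \<subseteq> Collect generic" "x \<in> T" "y \<in> T"
      unfolding Compl_Union_hyps connected_component_def by auto
    have nz: "a \<bullet> z \<noteq> 0" if "z \<in> T" for z using T(2) that a by (auto simp: generic_def)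
    show "sgn (a \<bullet> y) = sgn (a \<bullet> x)"
      using connected_ivt_hyperplane[OF T(1) T(3,4), of a 0] connected_ivt_hyperplane[OF T(1) T(4,3), of a 0]
        nz T(3,4) by (metis less_eq_real_def linorder_not_less sgn_1_neg sgn_1_pos)
  qed
qed

text \<open>Adding a small positive multiple of the generic point \<open>x\<close> to a point of the
  closed chamber turns all weak inequalities into strict ones.\<close>

lemma closure_sign_cell:
  assumes "generic x"
  shows "closure {y. \<forall>a\<in>V. sgn (a \<bullet> y) = sgn (a \<bullet> x)} = cchamber x" (is "closure ?C = _")
proof (rule antisym)
  have "cchamber x = (\<Inter>a\<in>V. {y. (sgn (a \<bullet> x) *\<^sub>R a) \<bullet> y \<ge> 0})"
    by (auto simp: cchamber_def)
  then have "closed (cchamber x)"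
    by (simp only:) (intro closed_INT ballI closed_halfspace_ge)
  moreover have "?C \<subseteq> cchamber x"
    using assms unfolding generic_def cchamber_def by (auto simp: sgn_if split: if_splits)
  ultimately show "closure ?C \<subseteq> cchamber x" by (rule closure_minimal[rotated])
  show "cchamber x \<subseteq> closure ?C"
  proof
    fix y assume y: "y \<in> cchamber x"
    have "y + t *\<^sub>R x \<in> ?C" if "t > 0" for t
    proof (intro CollectI ballI)
      fix a assume a: "a \<in> V"
      have "0 < sgn (a \<bullet> x) * (a \<bullet> x)" using assms a by (simp add: generic_def sgn_mult_pos_iff)
      then have "0 < sgn (a \<bullet> x) * (a \<bullet> y) + t * (sgn (a \<bullet> x) * (a \<bullet> x))"
        using y a that by (auto simp: cchamber_def add_nonneg_pos)
      also have "\<dots> = sgn (a \<bullet> x) * (a \<bullet> (y + t *\<^sub>R x))" by (simp add: inner_add_right algebra_simps)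
      finally show "sgn (a \<bullet> (y + t *\<^sub>R x)) = sgn (a \<bullet> x)" by (simp only: sgn_mult_pos_iff)
    qed
    moreover have "(\<lambda>n. y + inverse (real (Suc n)) *\<^sub>R x) \<longlonglongrightarrow> y + 0 *\<^sub>R x"
      by (intro tendsto_intros LIMSEQ_inverse_real_of_nat)
    ultimately show "y \<in> closure ?C"
      unfolding closure_sequential by (intro exI[of _ "\<lambda>n. y + inverse (real (Suc n)) *\<^sub>R x"]) auto
  qed
qed

lemma closed_chambers_hyps: "closed_chambers hyps = cchamber ` Collect generic"
proof -
  have "closed_chambers hyps = (\<lambda>x. closure (connected_component_set (- \<Union>hyps) x)) ` Collect generic"
    unfolding closed_chambers_def components_def Compl_Union_hyps by (simp add: image_image)
  also have "\<dots> = cchamber ` Collect generic"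
    by (rule image_cong) (simp_all add: component_eq_sign_cell closure_sign_cell)
  finally show ?thesis .
qed

lemma cchamber_generic_sgn:
  assumes "generic z" "z \<in> cchamber x" "a \<in> V" "generic x"
  shows "sgn (a \<bullet> z) = sgn (a \<bullet> x)"
  using assms by (fastforce simp: cchamber_def generic_def sgn_if split: if_splits)

lemma convex_cchamber: "convex (cchamber x)"
proof -
  have "cchamber x = (\<Inter>a\<in>V. {y. (sgn (a \<bullet> x) *\<^sub>R a) \<bullet> y \<ge> 0})"
    by (auto simp: cchamber_def)
  then show ?thesis
    by (simp only:) (intro convex_INT convex_halfspace_ge)
qed

text \<open>Every face lies in a chamber, so a maximal member is a chamber. No chamber lies properly
  inside another member, since the signs at one of its generic points already determine the
  chamber.\<close>

lemma maximal_cones_hyps: "maximal_cones (arrangement_faces hyps) = cchamber ` Collect generic"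
proof -
  have in_face: "cchamber x \<in> arrangement_faces hyps" if "generic x" for x
    using that face_of_refl[OF convex_cchamber] cchamber_self
    unfolding arrangement_faces_def closed_chambers_hyps by blast
  have in_chamber: "\<exists>x. generic x \<and> \<tau> face_of cchamber x" if "\<tau> \<in> arrangement_faces hyps" for \<tau>
    using that unfolding arrangement_faces_def closed_chambers_hyps by blast
  show ?thesis
  proof (intro equalityI subsetI)
    fix \<sigma> assume \<sigma>: "\<sigma> \<in> maximal_cones (arrangement_faces hyps)"
    then obtain x where "generic x" "\<sigma> face_of cchamber x"
      using in_chamber unfolding maximal_cones_def by blast
    then show "\<sigma> \<in> cchamber ` Collect generic"
      using \<sigma> in_face face_of_imp_subset unfolding maximal_cones_def by blast
  next
    fix \<sigma> assume "\<sigma> \<in> cchamber ` Collect generic"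
    then obtain x where x: "generic x" "\<sigma> = cchamber x" by blast
    have "\<sigma>' = \<sigma>" if \<sigma>': "\<sigma>' \<in> arrangement_faces hyps" "\<sigma> \<subseteq> \<sigma>'" for \<sigma>'
    proof -
      obtain z where z: "generic z" "\<sigma>' face_of cchamber z" using in_chamber \<sigma>' by blast
      then have "\<sigma>' \<subseteq> cchamber z" by (simp add: face_of_imp_subset)
      then have "x \<in> cchamber z" using \<sigma>' x cchamber_self by blast
      then have "cchamber x = cchamber z"
        using cchamber_generic_sgn[of x z] x z by (intro cchamber_cong) blast
      then show ?thesis using \<sigma>' x \<open>\<sigma>' \<subseteq> cchamber z\<close> by blast
    qed
    then show "\<sigma> \<in> maximal_cones (arrangement_faces hyps)"
      using in_face x unfolding maximal_cones_def by blast
  qed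
qed

text \<open>The set \<open>W\<close> is kept free because the path argument applies this to
  combinations of pairs of normals and not to \<open>V\<close>.\<close>

lemma ex_generic_in_open:
  fixes U :: "(real^'n) set"
  assumes "open U" "U \<noteq> {}" "finite W" "0 \<notin> W"
  shows "\<exists>z\<in>U. \<forall>w\<in>W. w \<bullet> z \<noteq> 0"
proof (rule open_avoids_hyperplanes[OF assms(1,2), of "(\<lambda>a. {x. a \<bullet> x = 0}) ` W"])
  show "finite ((\<lambda>a. {x. a \<bullet> x = 0}) ` W)" using assms(3) by simp
  fix A assume "A \<in> (\<lambda>a. {x. a \<bullet> x = 0}) ` W"
  then obtain a where a: "a \<in> W" "A = {x. a \<bullet> x = 0}" by blast
  moreover have "a \<noteq> 0" using a(1) assms(4) by blast
  ultimately show "\<exists>a b. a \<noteq> 0 \<and> A = {x. a \<bullet> x = b}" by blast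
next
  fix z assume "z \<in> U" "z \<notin> \<Union>((\<lambda>a. {x. a \<bullet> x = 0}) ` W)"
  then show ?thesis by blast
qed

section \<open>Walls and the two chambers beside them\<close>

lemma half_eq_cchamber_of_sgn:
  assumes "a \<in> V" "\<And>b. b \<in> V - {a} \<Longrightarrow> sgn (b \<bullet> x) = sgn (b \<bullet> p)"
  shows "half a p (sgn (a \<bullet> x)) = cchamber x"
proof -
  have "0 \<le> sgn (b \<bullet> x) * (b \<bullet> y) \<longleftrightarrow> 0 \<le> sgn (b \<bullet> p) * (b \<bullet> y)" if "b \<in> V - {a}" for b y
    using assms(2)[OF that] by simp
  then show ?thesis using assms(1) unfolding half_def cchamber_def by blast
qed

text \<open>A short step from \<open>p\<close> along the normal, to the side given by
  \<open>s\<close>, changes the sign of \<open>a\<close> only.\<close>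

lemma half_eq_cchamber:
  assumes "wall_point a p" "s = 1 \<or> s = -1"
  obtains x where "generic x" "half a p s = cchamber x" "sgn (a \<bullet> x) = s"
    "\<And>b. b \<in> V - {a} \<Longrightarrow> sgn (b \<bullet> x) = sgn (b \<bullet> p)"
proof -
  have a: "a \<in> V" "a \<bullet> p = 0" "\<And>b. b \<in> V - {a} \<Longrightarrow> b \<bullet> p \<noteq> 0" "a \<noteq> 0"
    using assms V_nonzero by (auto simp: wall_point_def)
  obtain e where e: "e > 0" "\<And>t b. \<bar>t\<bar> \<le> e \<Longrightarrow> b \<in> V - {a} \<Longrightarrow> sgn (b \<bullet> (p + t *\<^sub>R a)) = sgn (b \<bullet> p)"
    using finite_V by (rule sgn_inner_stable[OF finite_Diff a(3), where d = a]) blast+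
  define x where "x = p + (s * e) *\<^sub>R a"
  have xb: "sgn (b \<bullet> x) = sgn (b \<bullet> p)" if "b \<in> V - {a}" for b
    unfolding x_def using assms(2) e(1) that by (intro e(2)) auto
  have "a \<bullet> x = s * e * (a \<bullet> a)" using a unfolding x_def by (simp add: inner_add_right)
  then have xa: "sgn (a \<bullet> x) = s" using assms(2) e(1) a(4) by (auto simp: sgn_mult)
  have "generic x" unfolding generic_def using xa xb a assms(2)
    by (metis DiffI neg_equal_0_iff_equal sgn_0 sgn_0_0 singletonD zero_neq_one)
  moreover have "half a p s = cchamber x"
    using half_eq_cchamber_of_sgn[OF a(1) xb] xa by simp
  ultimately show thesis using that xa xb by blast
qed

text \<open>All forms except \<open>a\<close> are nonzero at \<open>p\<close>, so a chamber
  containing \<open>p\<close> is determined up to the sign of \<open>a\<close>.\<close>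

lemma half_unique:
  assumes "wall_point a p" "generic x" "p \<in> cchamber x"
  shows "cchamber x = half a p (sgn (a \<bullet> x))"
proof -
  have "sgn (b \<bullet> x) = sgn (b \<bullet> p)" if "b \<in> V - {a}" for b
  proof -
    have "b \<bullet> p \<noteq> 0" "b \<bullet> x \<noteq> 0" "0 \<le> sgn (b \<bullet> x) * (b \<bullet> p)"
      using assms that by (auto simp: wall_point_def generic_def cchamber_def)
    then show ?thesis by (auto simp: sgn_if split: if_splits)
  qed
  then show ?thesis using half_eq_cchamber_of_sgn assms(1) unfolding wall_point_def by metis
qed

lemma wall_eq_Int: "half a p 1 \<inter> half a p (-1) = wall a p"
  by (auto simp: half_def wall_def)

lemma mem_wall: "wall_point a p \<Longrightarrow> p \<in> wall a p"
  by (auto simp: wall_def wall_point_def sgn_if)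

lemma wall_near:
  assumes "wall_point a p" "a \<bullet> h = 0"
  obtains e where "e > 0" "p + e *\<^sub>R h \<in> wall a p"
proof -
  obtain e where e: "e > 0" "\<And>t b. \<bar>t\<bar> \<le> e \<Longrightarrow> b \<in> V - {a} \<Longrightarrow> sgn (b \<bullet> (p + t *\<^sub>R h)) = sgn (b \<bullet> p)"
    by (rule sgn_inner_stable[of "V - {a}" p h]) (use finite_V assms(1) in \<open>auto simp: wall_point_def\<close>)
  have "0 \<le> sgn (b \<bullet> p) * (b \<bullet> (p + e *\<^sub>R h))" if b: "b \<in> V - {a}" for b
    using e(2)[of e b, symmetric] e(1) b by (simp add: sgn_if)
  then have "p + e *\<^sub>R h \<in> wall a p"
    using assms unfolding wall_def wall_point_def by (simp add: inner_add_right)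
  then show thesis using that e(1) by blast
qed

text \<open>The wall contains a neighbourhood of \<open>p\<close> in the hyperplane, so each
  direction \<open>h\<close> is a multiple of a difference of two of its points.\<close>

lemma span_wall:
  assumes "wall_point a p"
  shows "span (wall a p) = {y. a \<bullet> y = 0}"
proof (rule antisym)
  show "span (wall a p) \<subseteq> {y. a \<bullet> y = 0}"
    by (rule span_minimal) (auto simp: wall_def subspace_hyperplane)
  show "{y. a \<bullet> y = 0} \<subseteq> span (wall a p)"
  proof (intro subsetI)
    fix h assume "h \<in> {y. a \<bullet> y = 0}"
    then have "a \<bullet> h = 0" by simp
    then obtain e where e: "e > 0" "p + e *\<^sub>R h \<in> wall a p" by (rule wall_near[OF assms])
    have "(1 / e) *\<^sub>R ((p + e *\<^sub>R h) - p) \<in> span (wall a p)"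
      by (intro span_scale span_diff span_base e mem_wall assms)
    then show "h \<in> span (wall a p)" using e(1) by simp
  qed
qed

lemma wall_face_of_half: "wall_point a p \<Longrightarrow> wall a p face_of half a p 1"
proof -
  assume wp: "wall_point a p"
  obtain x where "half a p 1 = cchamber x" by (rule half_eq_cchamber[OF wp, of 1]) auto
  then have "convex (half a p 1)" by (simp add: convex_cchamber)
  then have "half a p 1 \<inter> {y. a \<bullet> y = 0} face_of half a p 1"
    by (rule face_of_Int_supporting_hyperplane_ge) (simp add: half_def)
  moreover have "half a p 1 \<inter> {y. a \<bullet> y = 0} = wall a p" by (auto simp: half_def wall_def)
  ultimately show ?thesis by simp
qed

lemma wall_mem_walls:
  assumes "wall_point a p"
  shows "wall a p \<in> walls (arrangement_faces hyps)"
proof -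
  obtain x where x: "generic x" "half a p 1 = cchamber x" by (rule half_eq_cchamber[OF assms, of 1]) auto
  have "wall a p \<in> arrangement_faces hyps"
    unfolding arrangement_faces_def closed_chambers_hyps
    using x wall_face_of_half[OF assms] mem_wall[OF assms] by auto
  moreover have "dim (wall a p) + 1 = CARD('n)"
  proof -
    have "dim (wall a p) = dim {y. a \<bullet> y = 0}" using span_wall[OF assms] dim_span by metis
    also have "\<dots> = DIM(real^'n) - 1"
      using assms V_nonzero by (intro dim_hyperplane) (auto simp: wall_point_def)
    finally show ?thesis by simp
  qed
  ultimately show ?thesis unfolding walls_def by blast
qed

text \<open>Jumps telescope along a path of chambers; the induction is on the number of hyperplanes
  separating \<open>x\<close> from \<open>y\<close>. The difference of the two
  \<open>of_bool\<close> terms is the signed crossing of the hyperplane of \<open>a\<close>: 1, -1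
  or 0.\<close>

lemma jump_formula:
  fixes M :: "real^'n \<Rightarrow> real^'n" and c :: "real^'n \<Rightarrow> real"
  assumes jump: "\<And>a p x y. wall_point a p \<Longrightarrow> generic x \<Longrightarrow> generic y \<Longrightarrow> sgn (a \<bullet> x) = 1 \<Longrightarrow> sgn (a \<bullet> y) = -1 \<Longrightarrow>
      (\<And>b. b \<in> V - {a} \<Longrightarrow> sgn (b \<bullet> x) = sgn (b \<bullet> p) \<and> sgn (b \<bullet> y) = sgn (b \<bullet> p)) \<Longrightarrow> M x - M y = c a *\<^sub>R a"
    and cong: "\<And>x y. generic x \<Longrightarrow> generic y \<Longrightarrow> (\<And>a. a \<in> V \<Longrightarrow> sgn (a \<bullet> x) = sgn (a \<bullet> y)) \<Longrightarrow> M x = M y"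
    and "generic x" "generic y"
  shows "M y - M x = (\<Sum>a\<in>V. (c a * (of_bool (a \<bullet> y > 0) - of_bool (a \<bullet> x > 0))) *\<^sub>R a)"
proof -
  define D where "D x = {a\<in>V. sgn (a \<bullet> x) \<noteq> sgn (a \<bullet> y)}" for x
  show ?thesis
    using \<open>generic x\<close>
  proof (induction "card (D x)" arbitrary: x rule: less_induct)
    case less
    show ?case
    proof (cases "D x = {}")
      case True
      then have eq: "sgn (a \<bullet> x) = sgn (a \<bullet> y)" if "a \<in> V" for a using that by (auto simp: D_def)
      then have "M x = M y" using cong less.prems \<open>generic y\<close> by blast
      moreover have "(a \<bullet> x > 0) = (a \<bullet> y > 0)" if "a \<in> V" for a using eq[OF that] by (metis sgn_1_pos)
      ultimately show ?thesis by simp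
    next
      case False
      have xnz: "a \<bullet> x \<noteq> 0" if "a \<in> V" for a using less.prems that by (simp add: generic_def)
      have ynz: "a \<bullet> y \<noteq> 0" if "a \<in> V" for a using \<open>generic y\<close> that by (simp add: generic_def)
      \<comment> \<open>Perturbing \<open>y\<close> within its chamber makes the segment cross the hyperplanes one at a time;
        \<open>p\<close> below is the first crossing.\<close>
      define W where "W = (\<lambda>(a, b). (a \<bullet> x) *\<^sub>R b - (b \<bullet> x) *\<^sub>R a) ` {(a, b) \<in> V \<times> V. a \<noteq> b}"
      have "finite W" unfolding W_def using finite_V by (intro finite_imageI finite_subset[OF _ finite_cartesian_product]) auto
      moreover have "0 \<notin> W" unfolding W_def using not_parallel xnz by (force simp: image_iff)
      moreover have "open {z. \<forall>a\<in>V. sgn (a \<bullet> z) = sgn (a \<bullet> y)}"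
        using sign_cell(1)[OF finite_V] ynz by blast
      moreover have "{z. \<forall>a\<in>V. sgn (a \<bullet> z) = sgn (a \<bullet> y)} \<noteq> {}" by blast
      ultimately have "\<exists>y'\<in>{z. \<forall>a\<in>V. sgn (a \<bullet> z) = sgn (a \<bullet> y)}. \<forall>w\<in>W. w \<bullet> y' \<noteq> 0"
        by (intro ex_generic_in_open)
      then obtain y' where "y' \<in> {z. \<forall>a\<in>V. sgn (a \<bullet> z) = sgn (a \<bullet> y)}"
          and y'W: "\<And>w. w \<in> W \<Longrightarrow> w \<bullet> y' \<noteq> 0"
        by blast
      then have y': "\<And>a. a \<in> V \<Longrightarrow> sgn (a \<bullet> y') = sgn (a \<bullet> y)" by blast
      \<comment> \<open>If both forms change sign along the segment, equality would mean that they
        vanish at the same parameter.\<close>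
      have transversal: "(a \<bullet> x) * (b \<bullet> y') \<noteq> (b \<bullet> x) * (a \<bullet> y')" if "a \<in> V" "b \<in> V" "a \<noteq> b" for a b
      proof -
        have "(a \<bullet> x) *\<^sub>R b - (b \<bullet> x) *\<^sub>R a \<in> W" unfolding W_def using that by force
        from y'W[OF this] show ?thesis by (simp add: inner_diff_left)
      qed
      \<comment> \<open>For a form with opposite signs at \<open>x\<close> and \<open>y'\<close>,
        this is the parameter at which it vanishes on the segment.\<close>
      define T where "T a = \<bar>a \<bullet> x\<bar> / (\<bar>a \<bullet> x\<bar> + \<bar>a \<bullet> y'\<bar>)" for a
      have "finite (D x)" using finite_V by (simp add: D_def)
      then obtain a where a: "a \<in> D x" "\<And>b. b \<in> D x \<Longrightarrow> T a \<le> T b"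
        using ex_min_if_finite[of "T ` D x"] False by (metis (no_types, lifting) finite_imageI image_iff image_is_empty linorder_not_less)
      have aV: "a \<in> V" using a by (simp add: D_def)
      have y'nz: "b \<bullet> y' \<noteq> 0" if "b \<in> V" for b using y'[OF that] ynz[OF that] by (metis sgn_0_0)
      have T01: "0 < T a" "T a < 1" using xnz[OF aV] y'nz[OF aV] unfolding T_def by (auto simp: field_simps)
      define p where "p = (1 - T a) *\<^sub>R x + T a *\<^sub>R y'"
      have p: "b \<bullet> p = (1 - T a) * (b \<bullet> x) + T a * (b \<bullet> y')" for b
        unfolding p_def by (simp add: inner_add_right)
      \<comment> \<open>At \<open>p\<close>, a form that changes sign still has the sign from
        \<open>x\<close> exactly if its own crossing comes after that of \<open>a\<close>.\<close>
      have crossing: "sgn (b \<bullet> x) * (b \<bullet> p) = (\<bar>b \<bullet> x\<bar> + \<bar>b \<bullet> y'\<bar>) * (T b - T a)" if b: "b \<in> D x" for b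
      proof -
        have "sgn (b \<bullet> x) \<noteq> sgn (b \<bullet> y')" "b \<in> V" using b y' by (auto simp: D_def)
        then have "sgn (b \<bullet> x) * (b \<bullet> p) = (1 - T a) * \<bar>b \<bullet> x\<bar> - T a * \<bar>b \<bullet> y'\<bar>"
          unfolding p using xnz y'nz by (auto simp: sgn_if algebra_simps split: if_splits)
        moreover have "(\<bar>b \<bullet> x\<bar> + \<bar>b \<bullet> y'\<bar>) * T b = \<bar>b \<bullet> x\<bar>" unfolding T_def using xnz \<open>b \<in> V\<close> by (simp add: add_pos_nonneg less_imp_neq[symmetric])
        ultimately show ?thesis by (simp add: algebra_simps)
      qed
      have "sgn (a \<bullet> x) * (a \<bullet> p) = 0" using crossing[OF a(1)] by simp
      then have ap: "a \<bullet> p = 0" using xnz[OF aV] by (simp add: sgn_zero_iff)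
      \<comment> \<open>Forms in \<open>D x\<close> other than \<open>a\<close> cross strictly later
        than \<open>a\<close>; forms outside \<open>D x\<close> have equal signs at both ends of the
        segment.\<close>
      have bp: "sgn (b \<bullet> p) = sgn (b \<bullet> x)" if b: "b \<in> V - {a}" for b
      proof -
        have "0 < sgn (b \<bullet> x) * (b \<bullet> p)"
        proof (cases "b \<in> D x")
          case True
          have "T a \<noteq> T b"
          proof
            assume "T a = T b"
            then have eq: "\<bar>a \<bullet> x\<bar> * \<bar>b \<bullet> y'\<bar> = \<bar>b \<bullet> x\<bar> * \<bar>a \<bullet> y'\<bar>"
              unfolding T_def using xnz aV b by (simp add: frac_eq_eq add_pos_nonneg less_imp_neq[symmetric] algebra_simps)
            have sg: "sgn (a \<bullet> x) \<noteq> sgn (a \<bullet> y')" "sgn (b \<bullet> x) \<noteq> sgn (b \<bullet> y')"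
              using a(1) True y' by (auto simp: D_def)
            have "(a \<bullet> x) * (b \<bullet> y') = (b \<bullet> x) * (a \<bullet> y')"
              using eq sg xnz[OF aV] xnz[of b] y'nz[OF aV] y'nz[of b] b
              by (auto simp: sgn_if abs_if split: if_splits)
            then show False using transversal[of a b] aV b by auto
          qed
          then have "T a < T b" using a(2)[OF True] by simp
          then show ?thesis unfolding crossing[OF True] using xnz b by (intro mult_pos_pos) (auto simp: add_pos_nonneg)
        next
          case False
          then have "sgn (b \<bullet> y') = sgn (b \<bullet> x)" using b y' by (auto simp: D_def)
          then have "sgn (b \<bullet> x) * (b \<bullet> p) = (1 - T a) * \<bar>b \<bullet> x\<bar> + T a * \<bar>b \<bullet> y'\<bar>"
            unfolding p using xnz y'nz by (auto simp: sgn_if algebra_simps split: if_splits)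
          also have "\<dots> > 0" using T01 xnz b by (intro add_pos_nonneg mult_pos_pos) auto
          finally show ?thesis .
        qed
        then show ?thesis by (simp add: sgn_mult_pos_iff)
      qed
      have wp: "wall_point a p"
        unfolding wall_point_def using aV ap bp xnz by (metis DiffD1 sgn_0_0)
      have sgnx: "sgn (a \<bullet> x) = 1 \<or> sgn (a \<bullet> x) = -1" using xnz[OF aV] by (auto simp: sgn_if)
      \<comment> \<open>The point \<open>z\<close> lies just beyond the first crossing. It differs
        from \<open>x\<close> in the sign of \<open>a\<close> alone, so one separating hyperplane
        disappears.\<close>
      obtain z where z: "generic z" "sgn (a \<bullet> z) = - sgn (a \<bullet> x)" "\<And>b. b \<in> V - {a} \<Longrightarrow> sgn (b \<bullet> z) = sgn (b \<bullet> p)"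
        by (rule half_eq_cchamber[OF wp, of "- sgn (a \<bullet> x)"]) (use sgnx in auto)
      have az: "sgn (a \<bullet> z) = sgn (a \<bullet> y)"
        using a(1) z(2) sgnx ynz[OF aV] by (auto simp: D_def sgn_if split: if_splits)
      have bz: "sgn (b \<bullet> z) = sgn (b \<bullet> x)" if "b \<in> V" "b \<noteq> a" for b
        using z(3)[of b] bp[of b] that by simp
      have "D z = D x - {a}"
        by (rule set_eqI, rename_tac b, case_tac "b = a") (auto simp: D_def bz az)
      then have "card (D z) < card (D x)" using a(1) \<open>finite (D x)\<close> by (simp add: card_Diff1_less del: card_Diff_insert)
      then have IH: "M y - M z = (\<Sum>b\<in>V. (c b * (of_bool (b \<bullet> y > 0) - of_bool (b \<bullet> z > 0))) *\<^sub>R b)"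
        using less.hyps z(1) by blast
      have step: "M z - M x = (c a * (of_bool (a \<bullet> z > 0) - of_bool (a \<bullet> x > 0))) *\<^sub>R a"
      proof (cases "sgn (a \<bullet> x) = 1")
        case True
        then have "M x - M z = c a *\<^sub>R a" using jump[OF wp less.prems z(1)] z bp by simp
        then show ?thesis using True z(2) by (simp add: sgn_1_pos sgn_1_neg algebra_simps)
      next
        case False
        then have "sgn (a \<bullet> x) = -1" using sgnx by simp
        then show ?thesis using jump[OF wp z(1) less.prems] z bp by (simp add: sgn_1_pos sgn_1_neg)
      qed
      have "(b \<bullet> z > 0) = (b \<bullet> x > 0)" if "b \<in> V - {a}" for b
        using z(3)[OF that] bp[OF that] by (metis sgn_1_pos)
      then have "(\<Sum>b\<in>V. (c b * (of_bool (b \<bullet> z > 0) - of_bool (b \<bullet> x > 0))) *\<^sub>R b)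
          = (c a * (of_bool (a \<bullet> z > 0) - of_bool (a \<bullet> x > 0))) *\<^sub>R a"
        using sum.remove[OF finite_V aV, of "\<lambda>b. (c b * (of_bool (b \<bullet> z > 0) - of_bool (b \<bullet> x > 0))) *\<^sub>R b"] by simp
      then have "M y - M x = (\<Sum>b\<in>V. (c b * (of_bool (b \<bullet> y > 0) - of_bool (b \<bullet> z > 0))) *\<^sub>R b)
          + (\<Sum>b\<in>V. (c b * (of_bool (b \<bullet> z > 0) - of_bool (b \<bullet> x > 0))) *\<^sub>R b)"
        using IH step by (metis diff_add_cancel add_diff_eq)
      then show ?thesis by (simp add: sum.distrib[symmetric] scaleR_add_left[symmetric] distrib_left[symmetric])
    qed
  qed
qed

end

section \<open>Networks\<close>

lemma ReLU_Q_0_zero: "(\<lambda>x. 0) \<in> (ReLU_Q_0 :: (real^'n \<Rightarrow> real) set)"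
  unfolding ReLU_Q_0_def
  by (intro CollectI exI[of _ 0]) (auto simp: output_map_def fun_eq_iff)

lemma ReLU_Q_0_add_neuron:
  fixes g :: "real^'n \<Rightarrow> real"
  assumes "g \<in> ReLU_Q_0" "q \<in> \<rat>" "w \<in> rational_vectors"
  shows "(\<lambda>x. g x + q * max 0 (w \<bullet> x)) \<in> ReLU_Q_0"
proof -
  obtain k A c where g: "g = output_map k c \<circ> relu_layer \<circ> hidden_map k A"
    using assms(1) unfolding ReLU_Q_0_def by blast
  obtain q' where q': "q = of_rat q'" using assms(2) by (auto elim: Rats_cases)
  have "\<forall>j. \<exists>r. w $ j = of_rat r" using assms(3) unfolding rational_vectors_def by (auto elim: Rats_cases)
  then obtain w' where w': "\<And>j. w $ j = of_rat (w' j)" by metis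
  have "(\<lambda>x. g x + q * max 0 (w \<bullet> x))
      = output_map (Suc k) (c(k := q')) \<circ> relu_layer \<circ> hidden_map (Suc k) (A(k := w'))"
  proof
    fix x
    have "w \<bullet> x = (\<Sum>j\<in>UNIV. of_rat (w' j) * x $ j)" by (simp add: inner_vec_def w')
    then show "g x + q * max 0 (w \<bullet> x)
        = (output_map (Suc k) (c(k := q')) \<circ> relu_layer \<circ> hidden_map (Suc k) (A(k := w'))) x"
      unfolding g by (simp add: output_map_def relu_layer_def hidden_map_def q')
  qed
  then show ?thesis unfolding ReLU_Q_0_def by blast
qed

lemma ReLU_Q_0_sum:
  fixes c :: "real^'n \<Rightarrow> real"
  assumes "finite V" "g \<in> ReLU_Q_0" "\<And>a. a \<in> V \<Longrightarrow> c a \<in> \<rat> \<and> a \<in> rational_vectors"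
  shows "(\<lambda>x. g x + (\<Sum>a\<in>V. c a * max 0 (a \<bullet> x))) \<in> ReLU_Q_0"
  using assms(1,3)
proof (induction V rule: finite_induct)
  case empty
  then show ?case using assms(2) by simp
next
  case (insert a V)
  have "(\<lambda>x. g x + (\<Sum>b\<in>V. c b * max 0 (b \<bullet> x)) + c a * max 0 (a \<bullet> x)) \<in> ReLU_Q_0"
    using insert by (intro ReLU_Q_0_add_neuron) auto
  then show ?case using insert.hyps by (simp add: add_ac)
qed

text \<open>Two neurons suffice: a real number is its positive part minus the positive part of its
  negative.\<close>

lemma ReLU_Q_0_linear:
  fixes m :: "real^'n"
  assumes "m \<in> rational_vectors"
  shows "(\<lambda>x. m \<bullet> x) \<in> ReLU_Q_0"
proof -
  have "- m \<in> rational_vectors" using assms by (simp add: rational_vectors_def)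
  then have "(\<lambda>x. (\<lambda>x. 0 + 1 * max 0 (m \<bullet> x)) x + (-1) * max 0 (- m \<bullet> x)) \<in> ReLU_Q_0"
    using assms by (intro ReLU_Q_0_add_neuron ReLU_Q_0_zero) auto
  moreover have "(\<lambda>x. (\<lambda>x. 0 + 1 * max 0 (m \<bullet> x)) x + (-1) * max 0 (- m \<bullet> x)) = (\<lambda>x. m \<bullet> x)"
    by (auto simp: fun_eq_iff max_def)
  ultimately show ?thesis by simp
qed

text \<open>Adding enough copies of a vector on which all forms are positive pushes any vector into
  the cone; the multiple is natural so that lattice vectors stay in the lattice.\<close>

lemma ex_nat_multiple_dominates:
  fixes x y :: "'b \<Rightarrow> real"
  assumes "finite B" "\<And>b. b \<in> B \<Longrightarrow> y b > 0"
  shows "\<exists>k::nat. \<forall>b\<in>B. 0 \<le> x b + real k * y b"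
  using assms
proof (induction B rule: finite_induct)
  case (insert b B)
  then obtain k :: nat where k: "\<forall>b\<in>B. 0 \<le> x b + real k * y b" by auto
  obtain l :: nat where l: "- x b < real l * y b" using insert.prems reals_Archimedean3[of "y b"] by blast
  have mono: "x b' + real i * y b' \<le> x b' + real (k + l) * y b'" if "i \<le> k + l" "b' \<in> insert b B" for i b'
    using that insert.prems[of b'] by (intro add_left_mono mult_right_mono) auto
  show ?case
  proof (intro exI[of _ "k + l"] ballI)
    fix b' assume b': "b' \<in> insert b B"
    show "0 \<le> x b' + real (k + l) * y b'"
    proof (cases "b' = b")
      case True
      then show ?thesis using mono[of l b] l by simp
    next
      case False
      then have "0 \<le> x b' + real k * y b'" using k b' by blast
      then show ?thesis using mono[of k b'] b' by simp
    qed
  qed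
qed simp

section \<open>Gradient jumps and intersection numbers\<close>

text \<open>Only the set of hyperplanes is tied to \<open>f\<close>; the choice of normals stays
  free, so that the locale can be entered again with rational ones.\<close>

locale relu_arrangement = linear_arrangement V for V :: "(real^'n) set" +
  fixes f :: "real^'n \<Rightarrow> real"
  assumes full_hyperplanes_f: "full_hyperplanes f = hyps"
    and fan: "is_fan (relu_fan f)"
    and supp: "qcartier_support_function (relu_fan f) f"
begin

definition grad :: "(real^'n) set \<Rightarrow> real^'n" where
  "grad \<sigma> = (SOME m. m \<in> rational_vectors \<and> (\<forall>u\<in>\<sigma>. f u = m \<bullet> u))"

text \<open>The coefficient of the projection of the gradient difference to \<open>a\<close>;
  \<open>grad_jump\<close> shows that this is the whole difference. A priori it depends on the wall
  of \<open>p\<close>.\<close>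

definition jump :: "real^'n \<Rightarrow> real^'n \<Rightarrow> real" where
  "jump a p = ((grad (half a p 1) - grad (half a p (-1))) \<bullet> a) / (a \<bullet> a)"

lemma relu_fan_eq: "relu_fan f = arrangement_faces hyps"
  by (simp add: relu_fan_def full_hyperplanes_f)

lemma maximal_cones_eq: "maximal_cones (relu_fan f) = cchamber ` Collect generic"
  by (simp add: relu_fan_eq maximal_cones_hyps)

lemma cchamber_maximal: "generic x \<Longrightarrow> cchamber x \<in> maximal_cones (relu_fan f)"
  by (simp add: maximal_cones_eq)

lemma half_maximal:
  assumes "wall_point a p" "s = 1 \<or> s = -1"
  shows "half a p s \<in> maximal_cones (relu_fan f)"
  by (rule half_eq_cchamber[OF assms]) (simp add: cchamber_maximal)

lemma grad:
  assumes "\<sigma> \<in> maximal_cones (relu_fan f)"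
  shows "grad \<sigma> \<in> rational_vectors" and "u \<in> \<sigma> \<Longrightarrow> f u = grad \<sigma> \<bullet> u"
proof -
  have "\<exists>m. m \<in> rational_vectors \<and> (\<forall>u\<in>\<sigma>. f u = m \<bullet> u)"
    using supp assms unfolding qcartier_support_function_def by blast
  from someI_ex[OF this] show "grad \<sigma> \<in> rational_vectors" and "u \<in> \<sigma> \<Longrightarrow> f u = grad \<sigma> \<bullet> u"
    unfolding grad_def by blast+
qed

lemma fan_cone:
  assumes "\<sigma> \<in> relu_fan f"
  shows "rational_polyhedral_cone \<sigma>" "strongly_convex \<sigma>"
  using fan assms unfolding is_fan_def by blast+

lemma fan_face: "\<sigma> \<in> relu_fan f \<Longrightarrow> \<tau> face_of \<sigma> \<Longrightarrow> \<tau> \<noteq> {} \<Longrightarrow> \<tau> \<in> relu_fan f"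
  using fan unfolding is_fan_def by blast

text \<open>A chamber contains a generic \<open>x\<close> together with \<open>x + e d\<close> for
  small \<open>e\<close>, and the values of \<open>d\<close> there differ by
  \<open>e (d \<bullet> d)\<close>.\<close>

lemma orthogonal_to_maximal_cone:
  assumes "\<sigma> \<in> maximal_cones (relu_fan f)" "\<And>y. y \<in> \<sigma> \<Longrightarrow> d \<bullet> y = 0"
  shows "d = 0"
proof -
  obtain x where x: "generic x" "\<sigma> = cchamber x" using assms(1) unfolding maximal_cones_eq by blast
  then have nz: "\<And>b. b \<in> V \<Longrightarrow> b \<bullet> x \<noteq> 0" by (simp add: generic_def)
  obtain e where e: "e > 0" "\<And>t b. \<bar>t\<bar> \<le> e \<Longrightarrow> b \<in> V \<Longrightarrow> sgn (b \<bullet> (x + t *\<^sub>R d)) = sgn (b \<bullet> x)"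
    using sgn_inner_stable[OF finite_V nz, where d = d] by blast
  have "cchamber (x + e *\<^sub>R d) = cchamber x" using e by (intro cchamber_cong) auto
  then have "x + e *\<^sub>R d \<in> \<sigma>" "x \<in> \<sigma>" using cchamber_self x by blast+
  then have "d \<bullet> (x + e *\<^sub>R d) = 0" "d \<bullet> x = 0" using assms(2) by blast+
  then show ?thesis using e(1) by (simp add: inner_add_right)
qed

lemma cartier_data_grad: "cartier_data (relu_fan f) (relu_divisor f) grad"
  unfolding cartier_data_def relu_divisor_def
proof (intro ballI conjI impI)
  fix \<sigma> \<rho> assume \<sigma>: "\<sigma> \<in> maximal_cones (relu_fan f)" and \<rho>: "\<rho> \<in> rays (relu_fan f)" "\<rho> \<subseteq> \<sigma>"
  then obtain v where "v \<in> lattice_N" "v \<noteq> 0" "\<rho> = (\<lambda>t. t *\<^sub>R v) ` {0..}"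
    using one_dimensional_cone[OF fan_cone] unfolding rays_def by blast
  then have "ray_generator \<rho> \<in> \<sigma>" using lattice_points_of_ray(1) \<rho>(2) by blast
  then show "grad \<sigma> \<bullet> ray_generator \<rho> = - (- f (ray_generator \<rho>))" using grad(2)[OF \<sigma>] by simp
qed (rule grad(1))

text \<open>Cartier data are constrained only at ray generators. The extreme rays of a chamber are
  rays of the fan and span a full-dimensional cone, which determines the vector.\<close>

lemma cartier_data_unique:
  assumes m: "cartier_data (relu_fan f) (relu_divisor f) m" and \<sigma>: "\<sigma> \<in> maximal_cones (relu_fan f)"
  shows "m \<sigma> = grad \<sigma>"
proof -
  have \<sigma>F: "\<sigma> \<in> relu_fan f" using \<sigma> by (simp add: maximal_cones_def)
  obtain S where S: "S \<subseteq> lattice_N" "\<sigma> \<subseteq> span S"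
    "\<And>s. s \<in> S \<Longrightarrow> s \<noteq> 0 \<and> (\<lambda>t. t *\<^sub>R s) ` {0..} face_of \<sigma>"
    using cone_spanned_by_extreme_rays[OF fan_cone(1)[OF \<sigma>F] fan_cone(2)[OF \<sigma>F]] by blast
  have "(m \<sigma> - grad \<sigma>) \<bullet> s = 0" if s: "s \<in> S" for s
  proof -
    define \<rho> where "\<rho> = (\<lambda>t. t *\<^sub>R s) ` {0..}"
    have s0: "s \<noteq> 0" "\<rho> face_of \<sigma>" using S(3)[OF s] \<rho>_def by auto
    have s\<rho>: "s \<in> \<rho>" unfolding \<rho>_def by (rule image_eqI[of _ _ 1]) auto
    have "dim {s} \<le> dim \<rho>" using s\<rho> by (intro dim_subset) auto
    moreover have "\<rho> \<subseteq> span {s}" unfolding \<rho>_def by (auto simp: span_singleton)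
    then have "dim \<rho> \<le> dim {s}" by (metis dim_subset dim_span)
    ultimately have "dim \<rho> = 1" using s0(1) by simp
    moreover have "\<rho> \<in> relu_fan f" using fan_face[OF \<sigma>F s0(2)] s\<rho> by blast
    ultimately have "\<rho> \<in> rays (relu_fan f)" by (simp add: rays_def)
    moreover have "\<rho> \<subseteq> \<sigma>" using s0(2) face_of_imp_subset by blast
    ultimately have eq: "m \<sigma> \<bullet> ray_generator \<rho> = grad \<sigma> \<bullet> ray_generator \<rho>"
      using m cartier_data_grad \<sigma> unfolding cartier_data_def by simp
    have "ray_generator \<rho> \<in> \<rho>" "ray_generator \<rho> \<noteq> 0"
      using lattice_points_of_ray[OF _ s0(1) \<rho>_def] S(1) s by auto
    then obtain t where "ray_generator \<rho> = t *\<^sub>R s" "t \<noteq> 0" unfolding \<rho>_def by auto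
    then show ?thesis using eq by (simp add: inner_diff_left)
  qed
  then have "span S \<subseteq> {y. (m \<sigma> - grad \<sigma>) \<bullet> y = 0}"
    by (intro span_minimal subspace_hyperplane) auto
  then have "m \<sigma> - grad \<sigma> = 0" using S(2) by (intro orthogonal_to_maximal_cone[OF \<sigma>]) auto
  then show ?thesis by simp
qed

text \<open>Both gradients represent \<open>f\<close> on the common wall, whose span is the
  hyperplane, so their difference is a multiple of the normal.\<close>

lemma grad_jump:
  assumes wp: "wall_point a p"
  shows "grad (half a p 1) - grad (half a p (-1)) = jump a p *\<^sub>R a"
  unfolding jump_def
proof (rule parallel_if_vanishes_on_hyperplane)
  show "a \<noteq> 0" using wp V_nonzero by (auto simp: wall_point_def)
  let ?d = "grad (half a p 1) - grad (half a p (-1))"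
  have wall: "?d \<bullet> y = 0" if "y \<in> wall a p" for y
  proof -
    have "y \<in> half a p 1" "y \<in> half a p (-1)" using that unfolding wall_eq_Int[symmetric] by auto
    then have "f y = grad (half a p 1) \<bullet> y" "f y = grad (half a p (-1)) \<bullet> y"
      using grad(2)[OF half_maximal[OF wp]] by auto
    then show ?thesis by (simp add: inner_diff_left)
  qed
  have "span (wall a p) \<subseteq> {y. ?d \<bullet> y = 0}"
    using wall by (intro span_minimal subspace_hyperplane) auto
  then show "?d \<bullet> y = 0" if "a \<bullet> y = 0" for y
    using that unfolding span_wall[OF wp] by auto
qed

text \<open>The given \<open>p\<close> may be irrational. The sum of lattice generators of the wall
  replaces it: if some \<open>b\<close> vanished on all of them, it would vanish on the wall and
  hence at \<open>p\<close>.\<close>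

lemma ex_lattice_wall_point:
  assumes wp: "wall_point a p"
  shows "\<exists>p'\<in>lattice_N. a \<bullet> p' = 0 \<and> (\<forall>b\<in>V - {a}. 0 < sgn (b \<bullet> p) * (b \<bullet> p'))"
proof -
  have "wall a p \<in> relu_fan f" using wall_mem_walls[OF wp] unfolding relu_fan_eq walls_def by blast
  from fan_cone(1)[OF this] obtain S where S: "finite S" "S \<subseteq> lattice_N" "wall a p = convex_cone hull S"
    unfolding rational_polyhedral_cone_def by blast
  have SW: "s \<in> wall a p" if "s \<in> S" for s using S(3) that hull_inc by metis
  show ?thesis
  proof (intro bexI[of _ "\<Sum>S"] conjI ballI)
    show "\<Sum>S \<in> lattice_N" using S(2) by (intro lattice_N_sum) auto
    have "a \<bullet> s = 0" if "s \<in> S" for s using SW[OF that] by (simp add: wall_def)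
    then show "a \<bullet> \<Sum>S = 0" by (simp add: inner_sum_right)
    fix b assume b: "b \<in> V - {a}"
    have bp: "b \<bullet> p \<noteq> 0" using b wp by (simp add: wall_point_def)
    have nonneg: "0 \<le> sgn (b \<bullet> p) * (b \<bullet> s)" if "s \<in> S" for s
      using SW[OF that] b by (simp add: wall_def)
    have "\<exists>s\<in>S. sgn (b \<bullet> p) * (b \<bullet> s) \<noteq> 0"
    proof (rule ccontr)
      assume "\<not> ?thesis"
      then have "S \<subseteq> {y. b \<bullet> y = 0}" using bp by (auto simp: sgn_zero_iff)
      then have "convex_cone hull S \<subseteq> {y. b \<bullet> y = 0}"
        by (rule hull_minimal) (simp add: subspace_imp_convex_cone subspace_hyperplane)
      then show False using mem_wall[OF wp] bp S(3) by auto
    qed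
    then obtain s where "s \<in> S" "0 < sgn (b \<bullet> p) * (b \<bullet> s)" using nonneg by force
    then have "0 < (\<Sum>s\<in>S. sgn (b \<bullet> p) * (b \<bullet> s))" using S(1) nonneg by (intro sum_pos2) auto
    then show "0 < sgn (b \<bullet> p) * (b \<bullet> \<Sum>S)" by (simp add: inner_sum_right sum_distrib_left)
  qed
qed

lemma ex_translate_in_half:
  assumes wp: "wall_point a p" and p': "\<forall>b\<in>V - {a}. 0 < sgn (b \<bullet> p) * (b \<bullet> p')" "a \<bullet> p' = 0"
    and v: "0 \<le> s * (a \<bullet> v)"
  shows "\<exists>k::nat. v + real k *\<^sub>R p' \<in> half a p s"
proof -
  obtain k :: nat where k: "\<forall>b\<in>V - {a}. 0 \<le> sgn (b \<bullet> p) * (b \<bullet> v) + real k * (sgn (b \<bullet> p) * (b \<bullet> p'))"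
    using ex_nat_multiple_dominates[of "V - {a}" "\<lambda>b. sgn (b \<bullet> p) * (b \<bullet> p')" "\<lambda>b. sgn (b \<bullet> p) * (b \<bullet> v)"]
      finite_V p'(1) by auto
  have "v + real k *\<^sub>R p' \<in> half a p s"
    unfolding half_def using k v p'(2) by (auto simp: inner_add_right algebra_simps)
  then show ?thesis ..
qed

text \<open>Modulo the span of the wall only the value of \<open>a\<close> matters: a lattice vector
  in the relative interior of the wall supplies the translation that satisfies the remaining
  inequalities.\<close>

lemma lattice_above_wall:
  assumes wp: "wall_point a p"
  shows "{v \<in> lattice_N. \<exists>t\<in>span (wall a p). v + t \<in> half a p s} = {v \<in> lattice_N. 0 \<le> s * (a \<bullet> v)}"
proof -
  obtain p' where p': "a \<bullet> p' = 0" "\<forall>b\<in>V - {a}. 0 < sgn (b \<bullet> p) * (b \<bullet> p')"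
    using ex_lattice_wall_point[OF wp] by blast
  have "(\<exists>t\<in>span (wall a p). v + t \<in> half a p s) \<longleftrightarrow> 0 \<le> s * (a \<bullet> v)" for v
  proof
    assume "\<exists>t\<in>span (wall a p). v + t \<in> half a p s"
    then show "0 \<le> s * (a \<bullet> v)" unfolding span_wall[OF wp] by (auto simp: half_def inner_add_right)
  next
    assume "0 \<le> s * (a \<bullet> v)"
    then obtain k :: nat where k: "v + real k *\<^sub>R p' \<in> half a p s"
      using ex_translate_in_half[OF wp p'(2,1)] by blast
    show "\<exists>t\<in>span (wall a p). v + t \<in> half a p s"
      unfolding span_wall[OF wp] using k p'(1) by (intro bexI[of _ "real k *\<^sub>R p'"]) auto
  qed
  then show ?thesis by blast
qed

text \<open>The form \<open>a\<close> identifies the quotient lattice with the integer multiples of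
  \<open>a \<bullet> v0\<close>; on the side \<open>s\<close>, the minimal generator has value
  \<open>s * (a \<bullet> v0)\<close>.\<close>

lemma quotient_ray_generator_wall:
  assumes wp: "wall_point a p" and s: "s = 1 \<or> s = -1"
    and v0: "v0 \<in> lattice_N" "a \<bullet> v0 > 0" "\<And>v. v \<in> lattice_N \<Longrightarrow> \<exists>k::int. a \<bullet> v = of_int k * (a \<bullet> v0)"
  shows "quotient_ray_generator (wall a p) (half a p s) u \<longleftrightarrow>
    u \<in> half a p s \<inter> lattice_N \<and> s * (a \<bullet> u) = a \<bullet> v0"
proof -
  have R: "{v \<in> lattice_N. \<exists>k::nat. v - real k *\<^sub>R u \<in> span (wall a p) \<inter> lattice_N}
      = {v \<in> lattice_N. \<exists>k::nat. a \<bullet> v = real k * (a \<bullet> u)}" if "u \<in> lattice_N"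
    unfolding span_wall[OF wp] using that lattice_N_diff lattice_N_scaleR[of "real _" u]
    by (auto simp: inner_diff_right)
  have "{v \<in> lattice_N. 0 \<le> s * (a \<bullet> v)} = {v \<in> lattice_N. \<exists>k::nat. a \<bullet> v = real k * (a \<bullet> u)}
      \<longleftrightarrow> s * (a \<bullet> u) = a \<bullet> v0" if u: "u \<in> half a p s" "u \<in> lattice_N"
  proof
    \<comment> \<open>The vector \<open>s\<close> times \<open>v0\<close> serves as test: its value
      must be a natural multiple of that of \<open>u\<close>, which in turn is an integer multiple
      of the generator.\<close>
    assume eq: "{v \<in> lattice_N. 0 \<le> s * (a \<bullet> v)} = {v \<in> lattice_N. \<exists>k::nat. a \<bullet> v = real k * (a \<bullet> u)}"
    have "s *\<^sub>R v0 \<in> {v \<in> lattice_N. 0 \<le> s * (a \<bullet> v)}"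
      using v0 s lattice_N_minus by auto
    then obtain k :: nat where k: "s * (a \<bullet> v0) = real k * (a \<bullet> u)" unfolding eq by auto
    obtain j :: int where j: "a \<bullet> u = of_int j * (a \<bullet> v0)" using v0(3) u(2) by blast
    obtain i :: int where i: "s = of_int i" "i * i = 1" using s by (metis mult_1 minus_mult_minus of_int_1 of_int_minus)
    have "real_of_int i * (a \<bullet> v0) = of_int (int k * j) * (a \<bullet> v0)" using k unfolding j i by simp
    then have "i = int k * j" using v0(2) by (metis less_irrefl mult_right_cancel of_int_eq_iff)
    \<comment> \<open>An integer factorization of 1 with \<open>k\<close> natural leaves only
      \<open>i * j = 1\<close>.\<close>
    then have "int k * (i * j) = 1" using i(2) by (simp add: algebra_simps)
    then have "i * j = 1 \<or> i * j = -1 \<and> int k = -1" by (metis mult.commute zmult_eq_1_iff)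
    then have "i * j = 1" by auto
    then show "s * (a \<bullet> u) = a \<bullet> v0" unfolding i j by (metis mult.assoc mult_1 of_int_1 of_int_mult)
  next
    assume su: "s * (a \<bullet> u) = a \<bullet> v0"
    have "(\<exists>k::nat. a \<bullet> v = real k * (a \<bullet> u)) \<longleftrightarrow> 0 \<le> s * (a \<bullet> v)" if v: "v \<in> lattice_N" for v
    proof
      assume "\<exists>k::nat. a \<bullet> v = real k * (a \<bullet> u)"
      then obtain k :: nat where "a \<bullet> v = real k * (a \<bullet> u)" ..
      then have "s * (a \<bullet> v) = real k * (a \<bullet> v0)" using su by (metis mult.left_commute)
      then show "0 \<le> s * (a \<bullet> v)" using v0(2) by simp
    next
      assume nn: "0 \<le> s * (a \<bullet> v)"
      have "s *\<^sub>R v \<in> lattice_N" using v s lattice_N_minus by auto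
      then obtain k :: int where k: "s * (a \<bullet> v) = of_int k * (a \<bullet> v0)" using v0(3) by fastforce
      then have "k \<ge> 0" using nn v0(2) by (simp add: zero_le_mult_iff)
      then have "s * (a \<bullet> v) = s * (real (nat k) * (a \<bullet> u))" using k su by (simp add: algebra_simps)
      then have "a \<bullet> v = real (nat k) * (a \<bullet> u)" using s by auto
      then show "\<exists>k::nat. a \<bullet> v = real k * (a \<bullet> u)" ..
    qed
    then show "{v \<in> lattice_N. 0 \<le> s * (a \<bullet> v)} = {v \<in> lattice_N. \<exists>k::nat. a \<bullet> v = real k * (a \<bullet> u)}" by blast
  qed
  then show ?thesis
    unfolding quotient_ray_generator_def lattice_above_wall[OF wp] using R by blast
qed

lemma ex_quotient_ray_generator:
  assumes wp: "wall_point a p" and s: "s = 1 \<or> s = -1"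
    and v0: "v0 \<in> lattice_N" "a \<bullet> v0 > 0"
  shows "\<exists>u. u \<in> half a p s \<inter> lattice_N \<and> s * (a \<bullet> u) = a \<bullet> v0"
proof -
  obtain p' where p': "p' \<in> lattice_N" "a \<bullet> p' = 0" "\<forall>b\<in>V - {a}. 0 < sgn (b \<bullet> p) * (b \<bullet> p')"
    using ex_lattice_wall_point[OF wp] by blast
  have "0 \<le> s * (a \<bullet> (s *\<^sub>R v0))" using s v0(2) by auto
  then obtain k :: nat where k: "s *\<^sub>R v0 + real k *\<^sub>R p' \<in> half a p s"
    using ex_translate_in_half[OF wp p'(3,2)] by blast
  have "s *\<^sub>R v0 \<in> lattice_N" using s v0(1) lattice_N_minus by auto
  then have "s *\<^sub>R v0 + real k *\<^sub>R p' \<in> lattice_N" using p'(1) by (simp add: lattice_N_add lattice_N_scaleR)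
  moreover have "s * (a \<bullet> (s *\<^sub>R v0 + real k *\<^sub>R p')) = a \<bullet> v0" using s p'(2) by (auto simp: inner_add_right)
  ultimately show ?thesis using k by blast
qed

text \<open>Exchanging the two chambers reverses both the gradient difference and the sign of
  \<open>a \<bullet> u\<close>, so the value does not depend on their order.\<close>

lemma intersection_number_wall:
  assumes wp: "wall_point a p"
    and v0: "v0 \<in> lattice_N" "a \<bullet> v0 > 0" "\<And>v. v \<in> lattice_N \<Longrightarrow> \<exists>k::int. a \<bullet> v = of_int k * (a \<bullet> v0)"
  shows "intersection_number (relu_fan f) (relu_divisor f) (wall a p) = - (jump a p * (a \<bullet> v0))"
  unfolding intersection_number_def
proof (rule the_equality)
  have max: "half a p 1 \<in> maximal_cones (relu_fan f)" "half a p (-1) \<in> maximal_cones (relu_fan f)"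
    using half_maximal[OF wp] by auto
  obtain u where u: "u \<in> half a p 1 \<inter> lattice_N" "1 * (a \<bullet> u) = a \<bullet> v0"
    using ex_quotient_ray_generator[OF wp _ v0(1,2), of 1] by blast
  then have qu: "quotient_ray_generator (wall a p) (half a p 1) u"
    using quotient_ray_generator_wall[OF wp _ v0, of 1] by blast
  have "half a p (-1) \<noteq> half a p 1"
  proof
    assume "half a p (-1) = half a p 1"
    then have "a \<bullet> u \<le> 0" using u(1) by (auto simp: half_def)
    then show False using u(2) v0(2) by simp
  qed
  moreover have "- (jump a p * (a \<bullet> v0)) = (grad (half a p (-1)) - grad (half a p 1)) \<bullet> u"
  proof -
    have "grad (half a p (-1)) - grad (half a p 1) = - (jump a p *\<^sub>R a)"
      using grad_jump[OF wp] by (metis minus_diff_eq)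
    then show ?thesis using u(2) by simp
  qed
  moreover have "wall a p = half a p (-1) \<inter> half a p 1" using wall_eq_Int by blast
  ultimately show "\<exists>m \<sigma> \<sigma>' u. cartier_data (relu_fan f) (relu_divisor f) m \<and>
        \<sigma> \<in> maximal_cones (relu_fan f) \<and> \<sigma>' \<in> maximal_cones (relu_fan f) \<and> \<sigma> \<noteq> \<sigma>' \<and> wall a p = \<sigma> \<inter> \<sigma>' \<and>
        quotient_ray_generator (wall a p) \<sigma>' u \<and> - (jump a p * (a \<bullet> v0)) = (m \<sigma> - m \<sigma>') \<bullet> u"
    using cartier_data_grad max qu by blast
next
  fix q
  assume "\<exists>m \<sigma> \<sigma>' u. cartier_data (relu_fan f) (relu_divisor f) m \<and>
        \<sigma> \<in> maximal_cones (relu_fan f) \<and> \<sigma>' \<in> maximal_cones (relu_fan f) \<and> \<sigma> \<noteq> \<sigma>' \<and> wall a p = \<sigma> \<inter> \<sigma>' \<and>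
        quotient_ray_generator (wall a p) \<sigma>' u \<and> q = (m \<sigma> - m \<sigma>') \<bullet> u"
  then obtain m \<sigma> \<sigma>' u where m: "cartier_data (relu_fan f) (relu_divisor f) m"
    and \<sigma>: "\<sigma> \<in> maximal_cones (relu_fan f)" "\<sigma>' \<in> maximal_cones (relu_fan f)" "\<sigma> \<noteq> \<sigma>'"
    and W: "wall a p = \<sigma> \<inter> \<sigma>'" and qu: "quotient_ray_generator (wall a p) \<sigma>' u"
    and q: "q = (m \<sigma> - m \<sigma>') \<bullet> u" by blast
  \<comment> \<open>Both maximal cones contain the wall and hence \<open>p\<close>, and only the two
    halves at \<open>p\<close> do; being distinct, they are opposite halves.\<close>
  have side: "\<exists>s. (s = 1 \<or> s = -1) \<and> \<kappa> = half a p s" if \<kappa>: "\<kappa> \<in> maximal_cones (relu_fan f)" "p \<in> \<kappa>" for \<kappa>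
  proof -
    obtain x where x: "generic x" "\<kappa> = cchamber x" using \<kappa>(1) unfolding maximal_cones_eq by blast
    have "a \<bullet> x \<noteq> 0" using x wp by (auto simp: generic_def wall_point_def)
    then have "sgn (a \<bullet> x) = 1 \<or> sgn (a \<bullet> x) = -1" by (auto simp: sgn_if)
    then show ?thesis using half_unique[OF wp x(1)] x(2) \<kappa>(2) by blast
  qed
  have "p \<in> \<sigma>" "p \<in> \<sigma>'" using mem_wall[OF wp] W by auto
  then obtain s s' where s: "s = 1 \<or> s = -1" "\<sigma> = half a p s" and s': "s' = 1 \<or> s' = -1" "\<sigma>' = half a p s'"
    using side \<sigma> by blast
  then have "s = - s'" using \<sigma>(3) by auto
  then have "m \<sigma> - m \<sigma>' = - s' *\<^sub>R (grad (half a p 1) - grad (half a p (-1)))"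
    using cartier_data_unique[OF m] \<sigma> s s' by auto
  then have "q = - (jump a p * (s' * (a \<bullet> u)))" unfolding q grad_jump[OF wp] by (simp add: mult.left_commute)
  moreover have "s' * (a \<bullet> u) = a \<bullet> v0"
    using quotient_ray_generator_wall[OF wp s'(1) v0] qu s'(2) by blast
  ultimately show "q = - (jump a p * (a \<bullet> v0))" by simp
qed

text \<open>The hyperplane belongs to the arrangement because of a codimension-one polyhedron
  \<open>P\<close> in the non-linear locus. No other hyperplane contains \<open>P\<close>, so some
  point of \<open>P\<close> is a wall point, and a vanishing jump would make \<open>f\<close> linear
  near it.\<close>

lemma ex_nonlinear_wall_point:
  assumes a: "a \<in> V"
  shows "\<exists>p. wall_point a p \<and> jump a p \<noteq> 0"
proof -
  have "{x. a \<bullet> x = 0} \<in> full_hyperplanes f" using a unfolding full_hyperplanes_f hyps_def by blast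
  then obtain P where P: "{x. a \<bullet> x = 0} = affine hull P" "polyhedron P" "P \<subseteq> nonlinear_locus f"
      "aff_dim P = int CARD('n) - 1"
    unfolding full_hyperplanes_def by auto
  have "P \<noteq> {}" using P(1) by (metis (mono_tags) affine_hull_empty empty_iff inner_zero_right mem_Collect_eq)
  have "\<not> P \<subseteq> {x. b \<bullet> x = 0}" if b: "b \<in> V - {a}" for b
  proof
    assume "P \<subseteq> {x. b \<bullet> x = 0}"
    then have "affine hull P \<subseteq> {x. b \<bullet> x = 0}" by (simp add: hull_minimal affine_hyperplane)
    then have "b \<bullet> y = 0" if "a \<bullet> y = 0" for y using that P(1) by blast
    then have "b = ((b \<bullet> a) / (a \<bullet> a)) *\<^sub>R a"
      using a V_nonzero by (intro parallel_if_vanishes_on_hyperplane) auto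
    then show False using not_parallel[of b a 1 "(b \<bullet> a) / (a \<bullet> a)"] a b by simp
  qed
  then have "\<not> P \<subseteq> \<Union>((\<lambda>b. {x. b \<bullet> x = 0}) ` (V - {a}))"
    using convex_subset_Union_affine[of "(\<lambda>b. {x. b \<bullet> x = 0}) ` (V - {a})" P]
      finite_V polyhedron_imp_convex[OF P(2)] \<open>P \<noteq> {}\<close> affine_hyperplane by (auto simp del: Diff_iff)
  then obtain p where p: "p \<in> P" "\<forall>b\<in>V - {a}. b \<bullet> p \<noteq> 0" by blast
  have "a \<bullet> p = 0" using P(1) p(1) hull_subset[of P affine] by blast
  then have wp: "wall_point a p" using a p(2) by (simp add: wall_point_def)
  have "jump a p \<noteq> 0"
  proof
    assume "jump a p = 0"
    then have eq: "grad (half a p (-1)) = grad (half a p 1)" using grad_jump[OF wp] by simp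
    \<comment> \<open>This neighbourhood of \<open>p\<close> is covered by the two halves, on which
      \<open>f\<close> would have the same gradient.\<close>
    define U where "U = {y. \<forall>b\<in>V - {a}. sgn (b \<bullet> y) = sgn (b \<bullet> p)}"
    have "open U" unfolding U_def using p(2) finite_V by (intro sign_cell) auto
    moreover have "p \<in> U" by (simp add: U_def)
    moreover have "f y = grad (half a p 1) \<bullet> y" if "y \<in> U" for y
    proof -
      have "0 \<le> sgn (b \<bullet> p) * (b \<bullet> y)" if "b \<in> V - {a}" for b
      proof -
        have "sgn (b \<bullet> p) = sgn (b \<bullet> y)" using \<open>y \<in> U\<close> that by (simp add: U_def)
        then show ?thesis by (simp add: sgn_if)
      qed
      then have "y \<in> half a p 1 \<or> y \<in> half a p (-1)" unfolding half_def by auto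
      then show ?thesis using grad(2)[OF half_maximal[OF wp, of 1]] grad(2)[OF half_maximal[OF wp, of "-1"]] eq by auto
    qed
    then have "affine_linear_on U f"
      unfolding affine_linear_on_def by (intro exI[of _ "grad (half a p 1)"] exI[of _ 0]) auto
    ultimately show False using p(1) P(3) unfolding nonlinear_locus_def by blast
  qed
  then show ?thesis using wp by blast
qed

section \<open>Assembling the network\<close>

lemma jump_rational_vector:
  assumes "wall_point a p"
  shows "jump a p *\<^sub>R a \<in> rational_vectors"
  unfolding grad_jump[OF assms, symmetric]
  using half_maximal[OF assms] grad(1) by (intro rational_vectors_diff) auto

lemma ex_generic: "\<exists>x. generic x"
  using ex_generic_in_open[of UNIV V] finite_V V_nonzero by (auto simp: generic_def)

text \<open>A small shift of \<open>y\<close> in a generic direction keeps the nonzero signs and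
  makes the vanishing forms nonzero.\<close>

lemma ex_cchamber_containing: "\<exists>x. generic x \<and> y \<in> cchamber x"
proof -
  obtain x0 where x0: "generic x0" using ex_generic ..
  have fin: "finite {b\<in>V. b \<bullet> y \<noteq> 0}" using finite_V by simp
  have nz: "b \<bullet> y \<noteq> 0" if "b \<in> {b\<in>V. b \<bullet> y \<noteq> 0}" for b using that by simp
  obtain e where e: "e > 0" "\<And>t b. \<bar>t\<bar> \<le> e \<Longrightarrow> b \<in> {b\<in>V. b \<bullet> y \<noteq> 0} \<Longrightarrow> sgn (b \<bullet> (y + t *\<^sub>R x0)) = sgn (b \<bullet> y)"
    by (rule sgn_inner_stable[OF fin nz, where d = x0]) (assumption | rule that)+
  have *: "b \<bullet> (y + e *\<^sub>R x0) \<noteq> 0 \<and> 0 \<le> sgn (b \<bullet> (y + e *\<^sub>R x0)) * (b \<bullet> y)" if b: "b \<in> V" for b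
  proof (cases "b \<bullet> y = 0")
    case True
    then show ?thesis using e(1) x0 b by (simp add: generic_def inner_add_right)
  next
    case False
    then have "sgn (b \<bullet> (y + e *\<^sub>R x0)) = sgn (b \<bullet> y)" using e(2)[of e b] e(1) b by simp
    then show ?thesis using False by (metis abs_ge_zero mult.commute abs_sgn sgn_0_0)
  qed
  then show ?thesis by (intro exI[of _ "y + e *\<^sub>R x0"]) (auto simp: generic_def cchamber_def)
qed

lemma in_ReLU_Q_0:
  assumes rat: "V \<subseteq> rational_vectors"
    and const: "\<And>H \<tau>\<^sub>1 \<tau>\<^sub>2. H \<in> full_hyperplanes f \<Longrightarrow>
           \<tau>\<^sub>1 \<in> walls (relu_fan f) \<Longrightarrow> \<tau>\<^sub>2 \<in> walls (relu_fan f) \<Longrightarrow> \<tau>\<^sub>1 \<subseteq> H \<Longrightarrow> \<tau>\<^sub>2 \<subseteq> H \<Longrightarrow>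
           intersection_number (relu_fan f) (relu_divisor f) \<tau>\<^sub>1 =
           intersection_number (relu_fan f) (relu_divisor f) \<tau>\<^sub>2"
  shows "f \<in> ReLU_Q_0"
proof -
  have jump_const: "jump a p = jump a p'" if wp: "wall_point a p" "wall_point a p'" for a p p'
  proof -
    have a: "a \<in> V" "a \<noteq> 0" using wp V_nonzero by (auto simp: wall_point_def)
    obtain v0 where v0: "v0 \<in> lattice_N" "a \<bullet> v0 > 0" "\<And>v. v \<in> lattice_N \<Longrightarrow> \<exists>k::int. a \<bullet> v = of_int k * (a \<bullet> v0)"
      using rational_functional_generator[of a] a rat by blast
    have "{x. a \<bullet> x = 0} \<in> full_hyperplanes f" using a unfolding full_hyperplanes_f hyps_def by blast
    then have "intersection_number (relu_fan f) (relu_divisor f) (wall a p) =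
        intersection_number (relu_fan f) (relu_divisor f) (wall a p')"
      using wall_mem_walls[OF wp(1)] wall_mem_walls[OF wp(2)] unfolding relu_fan_eq[symmetric]
      by (rule const) (auto simp: wall_def)
    \<comment> \<open>The positive factor \<open>a \<bullet> v0\<close> is common to both walls and
      cancels.\<close>
    then show ?thesis using v0(2) intersection_number_wall[OF wp(1) v0] intersection_number_wall[OF wp(2) v0] by simp
  qed
  define c where "c a = jump a (SOME p. wall_point a p)" for a
  have c: "jump a p = c a" if "wall_point a p" for a p
    unfolding c_def using that by (intro jump_const) (auto intro: someI)
  have c_rat: "c a \<in> \<rat>" if a: "a \<in> V" for a
  proof -
    obtain p where "wall_point a p" using ex_nonlinear_wall_point[OF a] by blast
    then have "c a *\<^sub>R a \<in> rational_vectors" using jump_rational_vector c by metis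
    moreover obtain i where i: "a $ i \<noteq> 0" using a V_nonzero by (metis vec_eq_iff zero_index)
    moreover have "a $ i \<in> \<rat>" using rat a unfolding rational_vectors_def by blast
    \<comment> \<open>Only the product of \<open>c a\<close> with the vector \<open>a\<close> is
      known to be rational; dividing by a nonzero rational coordinate isolates
      \<open>c a\<close>.\<close>
    ultimately have "(c a * a $ i) / a $ i \<in> \<rat>" by (intro Rats_divide) (auto simp: rational_vectors_def)
    then show ?thesis using i by simp
  qed
  obtain x0 where x0: "generic x0" using ex_generic ..
  \<comment> \<open>The linear part of \<open>f\<close>: the gradient at \<open>x0\<close> without
    the contributions of the neurons active there.\<close>
  define m0 where "m0 = grad (cchamber x0) - (\<Sum>a\<in>V. (c a * of_bool (a \<bullet> x0 > 0)) *\<^sub>R a)"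
  have "m0 \<in> rational_vectors"
    unfolding m0_def using rat c_rat
    by (intro rational_vectors_diff rational_vectors_sum rational_vectors_scaleR grad(1) cchamber_maximal x0) auto
  have "f y = m0 \<bullet> y + (\<Sum>a\<in>V. c a * max 0 (a \<bullet> y))" for y
  proof -
    obtain x where x: "generic x" "y \<in> cchamber x" using ex_cchamber_containing by blast
    have "grad (cchamber x) - grad (cchamber x0)
        = (\<Sum>a\<in>V. (c a * (of_bool (a \<bullet> x > 0) - of_bool (a \<bullet> x0 > 0))) *\<^sub>R a)"
    proof (rule jump_formula[OF _ _ x0 x(1)])
      fix a p x y assume wp: "wall_point a p" and xy: "sgn (a \<bullet> x) = 1" "sgn (a \<bullet> y) = -1"
        "\<And>b. b \<in> V - {a} \<Longrightarrow> sgn (b \<bullet> x) = sgn (b \<bullet> p) \<and> sgn (b \<bullet> y) = sgn (b \<bullet> p)"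
      have "half a p 1 = cchamber x" "half a p (-1) = cchamber y"
        using half_eq_cchamber_of_sgn[of a x p] half_eq_cchamber_of_sgn[of a y p] xy wp
        by (auto simp: wall_point_def)
      then show "grad (cchamber x) - grad (cchamber y) = c a *\<^sub>R a"
        using grad_jump[OF wp] c[OF wp] by simp
    qed (metis cchamber_cong)
    then have g: "grad (cchamber x) = m0 + (\<Sum>a\<in>V. (c a * of_bool (a \<bullet> x > 0)) *\<^sub>R a)"
      unfolding m0_def by (simp add: right_diff_distrib scaleR_diff_left sum_subtractf algebra_simps)
    \<comment> \<open>The activation pattern at \<open>x\<close> is valid on the closed chamber,
      since at boundary points where \<open>a \<bullet> y = 0\<close> both sides vanish.\<close>
    have relu: "of_bool (a \<bullet> x > 0) * (a \<bullet> y) = max 0 (a \<bullet> y)" if "a \<in> V" for a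
      using x that by (auto simp: cchamber_def generic_def sgn_if max_def split: if_splits)
    have "f y = grad (cchamber x) \<bullet> y" using grad(2) cchamber_maximal x by blast
    also have "\<dots> = m0 \<bullet> y + (\<Sum>a\<in>V. c a * max 0 (a \<bullet> y))"
      unfolding g by (simp add: inner_add_left inner_sum_left relu[symmetric] mult.assoc)
    finally show ?thesis .
  qed
  then have "f = (\<lambda>y. m0 \<bullet> y + (\<Sum>a\<in>V. c a * max 0 (a \<bullet> y)))" by blast
  also have "\<dots> \<in> ReLU_Q_0"
    using rat c_rat \<open>m0 \<in> rational_vectors\<close> by (intro ReLU_Q_0_sum finite_V ReLU_Q_0_linear) auto
  finally show ?thesis .
qed

end

section \<open>Hyperplanes of a fan arrangement pass through the origin\<close>

lemma convex_component_hyperplane_arrangement: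
  fixes \<H> :: "('a::euclidean_space) set set"
  assumes hyp: "\<And>H. H \<in> \<H> \<Longrightarrow> \<exists>a b. a \<noteq> 0 \<and> H = {x. a \<bullet> x = b}"
  shows "convex (connected_component_set (- \<Union>\<H>) z)" (is "convex ?C")
  unfolding convex_contains_segment
proof (intro ballI)
  fix x y assume xy: "x \<in> ?C" "y \<in> ?C"
  \<comment> \<open>Connectedness puts \<open>x\<close> and \<open>y\<close> strictly on the same
    side of \<open>H\<close>, and open half-spaces are convex.\<close>
  have "closed_segment x y \<inter> H = {}" if H: "H \<in> \<H>" for H
  proof -
    obtain a b where ab: "H = {x. a \<bullet> x = b}" using hyp[OF H] by blast
    have "?C \<inter> H = {}" using connected_component_subset[of "- \<Union>\<H>" z] H by blast
    then have "a \<bullet> x \<noteq> b" "a \<bullet> y \<noteq> b" "\<not> (a \<bullet> x \<le> b \<and> b \<le> a \<bullet> y)" "\<not> (a \<bullet> y \<le> b \<and> b \<le> a \<bullet> x)"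
      using connected_ivt_hyperplane[OF connected_connected_component xy, of a b]
        connected_ivt_hyperplane[OF connected_connected_component xy(2,1), of a b] xy ab by blast+
    then have "{x, y} \<subseteq> {u. a \<bullet> u < b} \<or> {x, y} \<subseteq> {u. a \<bullet> u > b}" by auto
    then have "closed_segment x y \<subseteq> {u. a \<bullet> u < b} \<or> closed_segment x y \<subseteq> {u. a \<bullet> u > b}"
      unfolding segment_convex_hull by (metis hull_minimal convex_halfspace_lt convex_halfspace_gt)
    then show ?thesis unfolding ab by auto
  qed
  then have "closed_segment x y \<subseteq> - \<Union>\<H>" by blast
  then have "closed_segment x y \<subseteq> connected_component_set (- \<Union>\<H>) x"
    by (intro connected_component_maximal) auto
  then show "closed_segment x y \<subseteq> ?C" using connected_component_eq[OF xy(1)] by simp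
qed

lemma fan_arrangement_central:
  fixes \<H> :: "(real^'n) set set"
  assumes "finite \<H>" and hyp: "\<And>H. H \<in> \<H> \<Longrightarrow> \<exists>a b. a \<noteq> 0 \<and> H = {x. a \<bullet> x = b}"
    and fan: "is_fan (arrangement_faces \<H>)" and "H \<in> \<H>"
  shows "\<exists>a. a \<noteq> 0 \<and> H = {x. a \<bullet> x = 0}"
proof -
  obtain a b where ab: "a \<noteq> 0" "H = {x. a \<bullet> x = b}" using hyp \<open>H \<in> \<H>\<close> by blast
  have "b = 0"
  proof (rule ccontr)
    assume "b \<noteq> 0"
    \<comment> \<open>The normal is oriented away from the origin, so that the origin satisfies
      \<open>w \<bullet> x < \<bar>b\<bar>\<close>.\<close>
    define w where "w = sgn b *\<^sub>R a"
    have w: "w \<noteq> 0" "H = {x. w \<bullet> x = \<bar>b\<bar>}" using ab \<open>b \<noteq> 0\<close> by (auto simp: w_def sgn_if)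
    have "w \<bullet> ((2 * \<bar>b\<bar> / (w \<bullet> w)) *\<^sub>R w) = 2 * \<bar>b\<bar>" using w(1) by simp
    then have "(2 * \<bar>b\<bar> / (w \<bullet> w)) *\<^sub>R w \<in> {x. w \<bullet> x > \<bar>b\<bar>}" using \<open>b \<noteq> 0\<close> by simp
    then have "{x. w \<bullet> x > \<bar>b\<bar>} \<noteq> {}" by blast
    then obtain z where z: "w \<bullet> z > \<bar>b\<bar>" "z \<notin> \<Union>\<H>"
      using open_avoids_hyperplanes[OF open_halfspace_gt _ assms(1) hyp] by blast
    \<comment> \<open>The closed chamber of \<open>z\<close> lies beyond \<open>H\<close>, so it misses the origin and is not a cone.\<close>
    define C where "C = connected_component_set (- \<Union>\<H>) z"
    have zC: "z \<in> C" unfolding C_def using z(2) by (simp add: connected_component_refl)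
    have "convex (closure C)"
      unfolding C_def using hyp by (intro convex_closure convex_component_hyperplane_arrangement)
    then have "closure C face_of closure C" by (rule face_of_refl)
    moreover have "closure C \<in> closed_chambers \<H>"
      unfolding closed_chambers_def components_def C_def using z(2) by blast
    moreover have "closure C \<noteq> {}" using zC closure_subset by blast
    ultimately have "closure C \<in> arrangement_faces \<H>" unfolding arrangement_faces_def by blast
    then have "0 \<in> closure C"
      using fan convex_cone_hull_contains_0 unfolding is_fan_def rational_polyhedral_cone_def by metis
    moreover have "closure C \<subseteq> {x. w \<bullet> x \<ge> \<bar>b\<bar>}"
    proof (rule closure_minimal)
      show "C \<subseteq> {x. w \<bullet> x \<ge> \<bar>b\<bar>}"
      proof (rule ccontr)
        assume "\<not> ?thesis"
        then obtain x where x: "x \<in> C" "w \<bullet> x \<le> \<bar>b\<bar>" by force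
        have "connected C" unfolding C_def by simp
        then obtain u where "u \<in> C" "w \<bullet> u = \<bar>b\<bar>"
          using connected_ivt_hyperplane[OF _ x(1) zC x(2)] z(1) by force
        then show False using w(2) \<open>H \<in> \<H>\<close> connected_component_subset[of "- \<Union>\<H>" z] unfolding C_def by blast
      qed
    qed (rule closed_halfspace_ge)
    ultimately show False using \<open>b \<noteq> 0\<close> by auto
  qed
  then show ?thesis using ab by blast
qed

theorem theorem4:
  fixes f :: "real^'n \<Rightarrow> real"
  assumes "continuous_on UNIV f"
    and "finitely_piecewise_linear f"
    and "is_fan (relu_fan f)"
    and "qcartier_support_function (relu_fan f) f"
    and "\<And>H \<tau>\<^sub>1 \<tau>\<^sub>2. H \<in> full_hyperplanes f \<Longrightarrow>
           \<tau>\<^sub>1 \<in> walls (relu_fan f) \<Longrightarrow> \<tau>\<^sub>2 \<in> walls (relu_fan f) \<Longrightarrow>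
           \<tau>\<^sub>1 \<subseteq> H \<Longrightarrow> \<tau>\<^sub>2 \<subseteq> H \<Longrightarrow>
           intersection_number (relu_fan f) (relu_divisor f) \<tau>\<^sub>1 =
           intersection_number (relu_fan f) (relu_divisor f) \<tau>\<^sub>2"
  shows "f \<in> ReLU_Q_0"
proof -
  let ?\<H> = "full_hyperplanes f"
  \<comment> \<open>Stated for every choice of normals, because the rational ones become available
    only after a first interpretation.\<close>
  have arr: "relu_arrangement (nrm ` ?\<H>) f"
    if nrm: "\<And>H. H \<in> ?\<H> \<Longrightarrow> nrm H \<noteq> 0 \<and> H = {x. nrm H \<bullet> x = 0}" for nrm
  proof -
    have la: "linear_arrangement (nrm ` ?\<H>)"
    proof
      show "finite (nrm ` ?\<H>)" using finite_full_hyperplanes(1)[OF assms(2)] by simp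
      show "0 \<notin> nrm ` ?\<H>" using nrm by force
      show "inj_on (\<lambda>a. {x. a \<bullet> x = 0}) (nrm ` ?\<H>)"
      proof (intro inj_onI)
        fix u v assume "u \<in> nrm ` ?\<H>" "v \<in> nrm ` ?\<H>" "{x. u \<bullet> x = 0} = {x. v \<bullet> x = 0}"
        then show "u = v" using nrm by (metis imageE)
      qed
    qed
    have "(\<lambda>a. {x. a \<bullet> x = 0}) ` nrm ` ?\<H> = (\<lambda>H. H) ` ?\<H>"
      unfolding image_image by (rule image_cong) (use nrm in auto)
    then have "?\<H> = linear_arrangement.hyps (nrm ` ?\<H>)"
      by (simp add: linear_arrangement.hyps_def[OF la])
    then show ?thesis using la assms(3,4)
      unfolding relu_arrangement_def relu_arrangement_axioms_def by blast
  qed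
  have "\<forall>H\<in>?\<H>. \<exists>a. a \<noteq> 0 \<and> H = {x. a \<bullet> x = 0}"
    using fan_arrangement_central[OF finite_full_hyperplanes[OF assms(2)]] assms(3)
    unfolding relu_fan_def by blast
  then obtain nrm where nrm: "\<And>H. H \<in> ?\<H> \<Longrightarrow> nrm H \<noteq> 0 \<and> H = {x. nrm H \<bullet> x = 0}" by metis
  \<comment> \<open>The normals here are arbitrary; this interpretation serves to find the rational
    multiples \<open>r H\<close> used in the next one.\<close>
  interpret A: relu_arrangement "nrm ` ?\<H>" f by (rule arr[OF nrm])
  \<comment> \<open>Somewhere on \<open>H\<close> the gradient jumps by a nonzero vector, which is a rational normal of \<open>H\<close>.\<close>
  have "\<forall>H\<in>?\<H>. \<exists>r. r \<noteq> 0 \<and> r *\<^sub>R nrm H \<in> rational_vectors"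
    using A.ex_nonlinear_wall_point A.jump_rational_vector by blast
  then obtain r where r: "\<And>H. H \<in> ?\<H> \<Longrightarrow> r H \<noteq> 0 \<and> r H *\<^sub>R nrm H \<in> rational_vectors" by metis
  have "r H *\<^sub>R nrm H \<noteq> 0 \<and> H = {x. (r H *\<^sub>R nrm H) \<bullet> x = 0}" if "H \<in> ?\<H>" for H
    using nrm[OF that] r[OF that] by simp
  then interpret B: relu_arrangement "(\<lambda>H. r H *\<^sub>R nrm H) ` ?\<H>" f by (rule arr)
  show ?thesis using B.in_ReLU_Q_0 r assms(5) by blast
qed

end
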